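(* The group $\mathrm{QI}^{+}(\mathbb{R})$ cannot act effectively on the real line by homeomorphisms; that is, there is no injective group homomorphism $\mathrm{QI}^{+}(\mathbb{R})\to \mathrm{Homeo}(\mathbb{R})$.
   Context: A function $f:X\to Y$ between metric spaces is a quasi-isometry if there exist real numbers $K\ge 1$, $C\ge 0$ such that $\frac1K d(x_1,x_2)-C\le d(f(x_1),f(x_2))\le K d(x_1,x_2)+C$ for all $x_1,x_2\in X$, and $d(\mathrm{Im} f,y)\le C$ for every $y\in Y$. Two quasi-isometries $f,g$ are equivalent if $\sup_{x\in X}d(f(x),g(x))<\infty$. The quasi-isometry group $\mathrm{QI}(X)$ is the group of equivalence classes $[f]$ of quasi-isometries $f:X\to X$ under composition. The real line $\mathbb{R}$ carries the usual metric. $\mathrm{QI}^{+}(\mathbb{R})\le \mathrm{QI}(\mathbb{R})$ is the orientation-preserving subgroup: the classes $[f]$ with $f(x)\to+\infty$ as $x\to+\infty$ and $f(x)\to-\infty$ as $x\to-\infty$ (equivalently, the classes represented by increasing homeomorphisms of $\mathbb{R}$ that are quasi-isometries). $\mathrm{Homeo}(\mathbb{R})$ is the group of all homeomorphisms of $\mathbb{R}$; groups are regarded as abstract groups with no topology. *)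

theory Defs
  imports "HOL-Analysis.Analysis" "HOL-Algebra.Group"
begin

definition quasi_isometry :: "('a::metric_space \<Rightarrow> 'b::metric_space) \<Rightarrow> bool" where
  "quasi_isometry f \<longleftrightarrow>
     (\<exists>K C::real. K \<ge> 1 \<and> C \<ge> 0 \<and>
        (\<forall>x1 x2. 1 / K * dist x1 x2 - C \<le> dist (f x1) (f x2) \<and>
                 dist (f x1) (f x2) \<le> K * dist x1 x2 + C) \<and>
        (\<forall>y. infdist y (range f) \<le> C))"

definition qi_rel :: "(('a::metric_space \<Rightarrow> 'b::metric_space) \<times> ('a \<Rightarrow> 'b)) set" where
  "qi_rel = {(f, g). quasi_isometry f \<and> quasi_isometry g \<and>
                     bdd_above (range (\<lambda>x. dist (f x) (g x)))}"

text \<open>The product of two classes is formed as in the library's quotient constructions, as the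
  union of the classes of all composites of representatives; by
  \<open>qi_mult_class\<close> below, this is the class of any one such composite.\<close>

definition QI :: "('a::metric_space \<Rightarrow> 'a) set monoid" where
  "QI = \<lparr>carrier = {f. quasi_isometry f} // qi_rel,
         monoid.mult = (\<lambda>A B. \<Union>f\<in>A. \<Union>g\<in>B. qi_rel `` {f \<circ> g}),
         one = qi_rel `` {id}\<rparr>"

definition QI_plus :: "(real \<Rightarrow> real) set monoid" where
  "QI_plus = QI\<lparr>carrier := {qi_rel `` {f} | f. quasi_isometry f \<and>
                              filterlim f at_top at_top \<and> filterlim f at_bot at_bot}\<rparr>"

definition Homeo :: "('a::topological_space \<Rightarrow> 'a) monoid" where
  "Homeo = \<lparr>carrier = {h. \<exists>k. homeomorphism UNIV UNIV h k},
            monoid.mult = (\<circ>), one = id\<rparr>"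

lemma quasi_isometryD:
  assumes "quasi_isometry f"
  obtains K C where "K \<ge> 1" "C \<ge> 0"
    "\<And>x1 x2. dist x1 x2 \<le> K * dist (f x1) (f x2) + K * C"
    "\<And>x1 x2. dist (f x1) (f x2) \<le> K * dist x1 x2 + C"
    "\<And>y. \<exists>x. dist (f x) y \<le> C"
proof -
  obtain K C where KC: "K \<ge> 1" "C \<ge> 0"
    and l: "\<And>x1 x2. 1 / K * dist x1 x2 - C \<le> dist (f x1) (f x2)"
    and u: "\<And>x1 x2. dist (f x1) (f x2) \<le> K * dist x1 x2 + C"
    and d: "\<And>y. infdist y (range f) \<le> C"
    using assms unfolding quasi_isometry_def by blast
  show ?thesis
  proof (rule that[of K "C + 1"])
    show "dist x1 x2 \<le> K * dist (f x1) (f x2) + K * (C + 1)" for x1 x2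
    proof -
      have "dist x1 x2 = K * (1 / K * dist x1 x2)" using KC by simp
      also have "\<dots> \<le> K * (dist (f x1) (f x2) + C)"
        using l[of x1 x2] KC by (intro mult_left_mono) auto
      also have "\<dots> \<le> K * dist (f x1) (f x2) + K * (C + 1)"
        using KC by (simp add: algebra_simps)
      finally show ?thesis .
    qed
    show "dist (f x1) (f x2) \<le> K * dist x1 x2 + (C + 1)" for x1 x2
      using u[of x1 x2] by simp
    show "\<exists>x. dist (f x) y \<le> C + 1" for y
    proof (rule ccontr)
      assume "\<not> ?thesis"
      then have "\<And>x. C + 1 \<le> dist y (f x)" by (metis dist_commute linear)
      then have "C + 1 \<le> infdist y (range f)"
        unfolding infdist_def by (auto intro!: cINF_greatest)
      with d[of y] show False by simp
    qed
  qed (use KC in auto)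
qed

lemma quasi_isometryI:
  assumes "K \<ge> 1" "C \<ge> 0" "D \<ge> 0" "E \<ge> 0"
    and l: "\<And>x1 x2. dist x1 x2 \<le> K * dist (f x1) (f x2) + D"
    and u: "\<And>x1 x2. dist (f x1) (f x2) \<le> K * dist x1 x2 + C"
    and d: "\<And>y. \<exists>x. dist (f x) y \<le> E"
  shows "quasi_isometry f"
  unfolding quasi_isometry_def
proof (rule exI[of _ K], rule exI[of _ "C + D + E"], intro conjI allI)
  fix x1 x2
  have "1 / K * dist x1 x2 \<le> 1 / K * (K * dist (f x1) (f x2) + D)"
    using l[of x1 x2] assms(1) by (intro mult_left_mono) auto
  also have "\<dots> = dist (f x1) (f x2) + D / K" using assms(1) by (simp add: field_simps)
  also have "D / K \<le> D" using assms by (simp add: divide_le_eq mult_le_cancel_left1)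
  finally show "1 / K * dist x1 x2 - (C + D + E) \<le> dist (f x1) (f x2)" using assms by simp
  show "dist (f x1) (f x2) \<le> K * dist x1 x2 + (C + D + E)" using u[of x1 x2] assms(3,4) by linarith
next
  fix y
  obtain x where "dist (f x) y \<le> E" using d by blast
  then have "infdist y (range f) \<le> E"
    by (metis dist_commute infdist_le order_trans rangeI)
  then show "infdist y (range f) \<le> C + D + E" using assms by simp
qed (use assms in auto)

lemma quasi_isometry_id: "quasi_isometry (id :: 'a::metric_space \<Rightarrow> 'a)"
  by (rule quasi_isometryI[of 1 0 0 0]) auto

lemma quasi_isometry_comp:
  assumes "quasi_isometry f" "quasi_isometry g"
  shows "quasi_isometry (f \<circ> g)"
proof -
  obtain K C where f: "K \<ge> 1" "C \<ge> 0"
    "\<And>x1 x2. dist x1 x2 \<le> K * dist (f x1) (f x2) + K * C"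
    "\<And>x1 x2. dist (f x1) (f x2) \<le> K * dist x1 x2 + C"
    "\<And>y. \<exists>x. dist (f x) y \<le> C" using quasi_isometryD[OF assms(1)] by metis
  obtain L D where g: "L \<ge> 1" "D \<ge> 0"
    "\<And>x1 x2. dist x1 x2 \<le> L * dist (g x1) (g x2) + L * D"
    "\<And>x1 x2. dist (g x1) (g x2) \<le> L * dist x1 x2 + D"
    "\<And>y. \<exists>x. dist (g x) y \<le> D" using quasi_isometryD[OF assms(2)] by metis
  show ?thesis
  proof (rule quasi_isometryI[of "K * L" "K * D + C" "L * (K * C) + L * D" "K * D + C + C"])
    show "K * L \<ge> 1" using f(1) g(1) mult_mono[of 1 K 1 L] by simp
    show "dist x1 x2 \<le> K * L * dist ((f \<circ> g) x1) ((f \<circ> g) x2) + (L * (K * C) + L * D)" for x1 x2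
      using g(3)[of x1 x2] g(1) mult_left_mono[OF f(3)[of "g x1" "g x2"], of L]
      by (simp add: algebra_simps)
    show "dist ((f \<circ> g) x1) ((f \<circ> g) x2) \<le> K * L * dist x1 x2 + (K * D + C)" for x1 x2
      using f(4)[of "g x1" "g x2"] f(1) mult_left_mono[OF g(4)[of x1 x2], of K]
      by (simp add: algebra_simps)
    show "\<exists>x. dist ((f \<circ> g) x) y \<le> K * D + C + C" for y
    proof -
      obtain z where z: "dist (f z) y \<le> C" using f(5) by blast
      obtain x where x: "dist (g x) z \<le> D" using g(5) by blast
      have "dist (f (g x)) y \<le> dist (f (g x)) (f z) + dist (f z) y" by (rule dist_triangle)
      also have "\<dots> \<le> K * dist (g x) z + C + C" using f(4)[of "g x" z] z by simp
      also have "K * dist (g x) z \<le> K * D" using x f(1) by (intro mult_left_mono) auto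
      finally show ?thesis by (intro exI[of _ x]) simp
    qed
  qed (use f g in auto)
qed

lemma qi_rel_iff:
  "(f, g) \<in> qi_rel \<longleftrightarrow>
     quasi_isometry f \<and> quasi_isometry g \<and> (\<exists>B. \<forall>x. dist (f x) (g x) \<le> B)"
  by (auto simp: qi_rel_def bdd_above_def)

lemma equiv_qi_rel: "equiv {f. quasi_isometry f} qi_rel"
proof (rule equivI)
  show "qi_rel \<subseteq> {f::'a \<Rightarrow> 'b. quasi_isometry f} \<times> {f. quasi_isometry f}"
    by (auto simp: qi_rel_def)
  show "refl_on {f::'a \<Rightarrow> 'b. quasi_isometry f} qi_rel"
    by (auto simp: refl_on_def qi_rel_iff intro: exI[of _ 0])
  show "sym (qi_rel :: (('a \<Rightarrow> 'b) \<times> _) set)"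
    by (auto simp: sym_def qi_rel_iff dist_commute)
  show "trans (qi_rel :: (('a \<Rightarrow> 'b) \<times> _) set)"
  proof (rule transI)
    fix f g h :: "'a \<Rightarrow> 'b"
    assume "(f, g) \<in> qi_rel" "(g, h) \<in> qi_rel"
    then obtain A B where "\<And>x. dist (f x) (g x) \<le> A" "\<And>x. dist (g x) (h x) \<le> B"
      and q: "quasi_isometry f" "quasi_isometry h" by (auto simp: qi_rel_iff)
    then have "dist (f x) (h x) \<le> A + B" for x
      by (meson add_mono dist_triangle_le order_trans dist_triangle)
    with q show "(f, h) \<in> qi_rel" by (auto simp: qi_rel_iff)
  qed
qed

lemma qi_rel_comp:
  assumes "(f, f') \<in> qi_rel" "(g, g') \<in> qi_rel"
  shows "(f \<circ> g, f' \<circ> g') \<in> qi_rel"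
proof -
  obtain A B where AB: "\<And>x. dist (f x) (f' x) \<le> A" "\<And>x. dist (g x) (g' x) \<le> B"
    and q: "quasi_isometry f" "quasi_isometry f'" "quasi_isometry g" "quasi_isometry g'"
    using assms by (auto simp: qi_rel_iff)
  obtain K C where f: "K \<ge> 1" "\<And>x1 x2. dist (f x1) (f x2) \<le> K * dist x1 x2 + C"
    using quasi_isometryD[OF q(1)] by metis
  have "dist (f (g x)) (f' (g' x)) \<le> K * B + C + A" for x
  proof -
    have "dist (f (g x)) (f' (g' x)) \<le> dist (f (g x)) (f (g' x)) + dist (f (g' x)) (f' (g' x))"
      by (rule dist_triangle)
    also have "\<dots> \<le> K * dist (g x) (g' x) + C + A"
      using f(2)[of "g x" "g' x"] AB(1)[of "g' x"] by simp
    also have "K * dist (g x) (g' x) \<le> K * B" using AB(2) f(1) by (intro mult_left_mono) auto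
    finally show ?thesis by simp
  qed
  then show ?thesis using q by (auto simp: qi_rel_iff quasi_isometry_comp)
qed

lemma qi_rel_classI: "quasi_isometry f \<Longrightarrow> qi_rel `` {f} \<in> carrier QI"
  by (auto simp: QI_def intro: quotientI)

lemma qi_rel_classE:
  assumes "A \<in> carrier QI"
  obtains f where "quasi_isometry f" "A = qi_rel `` {f}"
  using assms by (auto simp: QI_def elim: quotientE)

lemma qi_mult_class:
  assumes "quasi_isometry f" "quasi_isometry g"
  shows "qi_rel `` {f} \<otimes>\<^bsub>QI\<^esub> qi_rel `` {g} = qi_rel `` {f \<circ> g}"
proof -
  have "(\<Union>f'\<in>qi_rel `` {f}. \<Union>g'\<in>qi_rel `` {g}. qi_rel `` {f' \<circ> g'}) =
        (\<Union>f'\<in>qi_rel `` {f}. \<Union>g'\<in>qi_rel `` {g}. qi_rel `` {f \<circ> g})"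
  proof (intro SUP_cong refl)
    fix f' g' assume "f' \<in> qi_rel `` {f}" "g' \<in> qi_rel `` {g}"
    then have "(f \<circ> g, f' \<circ> g') \<in> qi_rel" by (intro qi_rel_comp) simp_all
    then show "qi_rel `` {f' \<circ> g'} = qi_rel `` {f \<circ> g}"
      using equiv_class_eq[OF equiv_qi_rel] by metis
  qed
  also have "f \<in> qi_rel `` {f}" "g \<in> qi_rel `` {g}"
    using assms by (auto simp: qi_rel_iff intro: exI[of _ 0])
  then have "(\<Union>f'\<in>qi_rel `` {f}. \<Union>g'\<in>qi_rel `` {g}. qi_rel `` {f \<circ> g}) =
             qi_rel `` {f \<circ> g}"
    by blast
  finally show ?thesis by (simp add: QI_def)
qed

lemma quasi_inverse:
  assumes "quasi_isometry f"
  obtains g where "quasi_isometry g" "(g \<circ> f, id) \<in> qi_rel" "(f \<circ> g, id) \<in> qi_rel"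
proof -
  obtain K C where f: "K \<ge> 1" "C \<ge> 0"
    "\<And>x1 x2. dist x1 x2 \<le> K * dist (f x1) (f x2) + K * C"
    "\<And>x1 x2. dist (f x1) (f x2) \<le> K * dist x1 x2 + C"
    "\<And>y. \<exists>x. dist (f x) y \<le> C" using quasi_isometryD[OF assms(1)] by metis
  obtain g where g: "\<And>y. dist (f (g y)) y \<le> C" using f(5) by metis
  have gf: "dist (g (f x)) x \<le> K * C + K * C" for x
    using f(3)[of "g (f x)" x] mult_left_mono[OF g[of "f x"], of K] f(1) by linarith
  have q: "quasi_isometry g"
  proof (rule quasi_isometryI[of K "K * C + K * C + K * C" "C + C + C" "K * C + K * C"])
    fix x1 x2
    have "dist x1 x2 \<le> dist x1 (f (g x1)) + dist (f (g x1)) x2" by (rule dist_triangle)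
    moreover have "dist (f (g x1)) x2 \<le> dist (f (g x1)) (f (g x2)) + dist (f (g x2)) x2"
      by (rule dist_triangle)
    ultimately show "dist x1 x2 \<le> K * dist (g x1) (g x2) + (C + C + C)"
      using g[of x1] g[of x2] f(4)[of "g x1" "g x2"] dist_commute[of x1 "f (g x1)"] by simp
    have "dist (f (g x1)) (f (g x2)) \<le> dist (f (g x1)) x1 + dist x1 (f (g x2))"
      by (rule dist_triangle)
    moreover have "dist x1 (f (g x2)) \<le> dist x1 x2 + dist x2 (f (g x2))" by (rule dist_triangle)
    ultimately have "dist (f (g x1)) (f (g x2)) \<le> dist x1 x2 + C + C"
      using g[of x1] g[of x2] dist_commute[of x2 "f (g x2)"] by simp
    then have "K * dist (f (g x1)) (f (g x2)) \<le> K * (dist x1 x2 + C + C)"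
      using f(1) by (intro mult_left_mono) auto
    then show "dist (g x1) (g x2) \<le> K * dist x1 x2 + (K * C + K * C + K * C)"
      using f(3)[of "g x1" "g x2"] by (simp add: algebra_simps)
  next
    show "\<exists>x. dist (g x) y \<le> K * C + K * C" for y using gf[of y] by blast
  qed (use f in auto)
  show ?thesis
  proof (rule that[OF q])
    show "(g \<circ> f, id) \<in> qi_rel"
      using q assms gf by (auto simp: qi_rel_iff quasi_isometry_comp quasi_isometry_id)
    show "(f \<circ> g, id) \<in> qi_rel"
      using q assms g by (auto simp: qi_rel_iff quasi_isometry_comp quasi_isometry_id)
  qed
qed

lemma group_QI: "group (QI :: ('a::metric_space \<Rightarrow> 'a) set monoid)"
proof (rule groupI)
  fix x y z :: "('a \<Rightarrow> 'a) set"
  assume "x \<in> carrier QI" "y \<in> carrier QI" "z \<in> carrier QI"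
  then obtain f g h where *: "quasi_isometry f" "quasi_isometry g" "quasi_isometry h"
    "x = qi_rel `` {f}" "y = qi_rel `` {g}" "z = qi_rel `` {h}"
    by (metis qi_rel_classE)
  then show "x \<otimes>\<^bsub>QI\<^esub> y \<in> carrier QI"
    by (auto simp: qi_mult_class quasi_isometry_comp intro!: qi_rel_classI)
  from * show "x \<otimes>\<^bsub>QI\<^esub> y \<otimes>\<^bsub>QI\<^esub> z = x \<otimes>\<^bsub>QI\<^esub> (y \<otimes>\<^bsub>QI\<^esub> z)"
    by (simp add: qi_mult_class quasi_isometry_comp comp_assoc)
next
  have one: "\<one>\<^bsub>QI\<^esub> = qi_rel `` {id :: 'a \<Rightarrow> 'a}" by (simp add: QI_def)
  then show "\<one>\<^bsub>QI\<^esub> \<in> carrier (QI :: ('a \<Rightarrow> 'a) set monoid)"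
    by (auto simp: quasi_isometry_id intro!: qi_rel_classI)
  fix x :: "('a \<Rightarrow> 'a) set"
  assume "x \<in> carrier QI"
  then obtain f where f: "quasi_isometry f" "x = qi_rel `` {f}" by (rule qi_rel_classE)
  then show "\<one>\<^bsub>QI\<^esub> \<otimes>\<^bsub>QI\<^esub> x = x" by (simp add: one qi_mult_class quasi_isometry_id)
  obtain g where "quasi_isometry g" "(g \<circ> f, id) \<in> qi_rel" using quasi_inverse f(1) by blast
  with f show "\<exists>y\<in>carrier QI. y \<otimes>\<^bsub>QI\<^esub> x = \<one>\<^bsub>QI\<^esub>"
    by (intro bexI[of _ "qi_rel `` {g}"])
       (auto simp: one qi_mult_class intro!: qi_rel_classI equiv_class_eq[OF equiv_qi_rel])
qed

lemma quasi_inverse_orientation: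
  fixes f g :: "real \<Rightarrow> real"
  assumes q: "quasi_isometry f" and fg: "(f \<circ> g, id) \<in> qi_rel"
    and f: "filterlim f at_top at_top" "filterlim f at_bot at_bot"
  shows "filterlim g at_top at_top" "filterlim g at_bot at_bot"
proof -
  obtain K C where KC: "K \<ge> 1" "\<And>x1 x2. dist (f x1) (f x2) \<le> K * dist x1 x2 + C"
    using quasi_isometryD[OF q] by metis
  obtain B where B: "\<And>x. dist (f (g x)) x \<le> B" using fg by (auto simp: qi_rel_iff)
  show "filterlim g at_top at_top"
    unfolding filterlim_at_top
  proof
    fix M
    obtain N where N: "\<And>x. x \<le> N \<Longrightarrow> f x \<le> 0"
      using f(2) unfolding filterlim_at_bot eventually_at_bot_linorder by metis
    define R where "R = max 0 (f N + K * \<bar>M - N\<bar> + C)"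
    have "f x \<le> R" if "x \<le> M" for x
    proof (cases "x \<le> N")
      case False
      have "f x \<le> f N + K * \<bar>x - N\<bar> + C" using KC(2)[of x N] by (simp add: dist_real_def)
      also have "K * \<bar>x - N\<bar> \<le> K * \<bar>M - N\<bar>"
        using KC(1) that False by (intro mult_left_mono) auto
      finally show ?thesis by (simp add: R_def)
    qed (use N[of x] in \<open>auto simp: R_def\<close>)
    then have "M \<le> g y" if "y > R + B" for y
      using B[of y] that unfolding dist_real_def by (smt (verit))
    then show "\<forall>\<^sub>F y in at_top. M \<le> g y"
      by (metis (mono_tags, lifting) eventually_at_top_dense)
  qed
  show "filterlim g at_bot at_bot"
    unfolding filterlim_at_bot
  proof
    fix M
    obtain N where N: "\<And>x. x \<ge> N \<Longrightarrow> f x \<ge> 0"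
      using f(1) unfolding filterlim_at_top eventually_at_top_linorder by metis
    define R where "R = min 0 (f N - K * \<bar>M - N\<bar> - C)"
    have "f x \<ge> R" if "x \<ge> M" for x
    proof (cases "x \<ge> N")
      case False
      have "f x \<ge> f N - K * \<bar>x - N\<bar> - C" using KC(2)[of x N] by (simp add: dist_real_def)
      moreover have "K * \<bar>x - N\<bar> \<le> K * \<bar>M - N\<bar>"
        using KC(1) that False by (intro mult_left_mono) auto
      ultimately show ?thesis by (simp add: R_def)
    qed (use N[of x] in \<open>auto simp: R_def\<close>)
    then have "M \<ge> g y" if "y < R - B" for y
      using B[of y] that unfolding dist_real_def by (smt (verit))
    then show "\<forall>\<^sub>F y in at_bot. M \<ge> g y"
      by (metis (mono_tags, lifting) eventually_at_bot_dense)
  qed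
qed

lemma subgroup_QI_plus: "subgroup (carrier QI_plus) (QI :: (real \<Rightarrow> real) set monoid)"
proof -
  interpret group "QI :: (real \<Rightarrow> real) set monoid" by (rule group_QI)
  let ?P = "\<lambda>f::real \<Rightarrow> real. quasi_isometry f \<and> filterlim f at_top at_top \<and> filterlim f at_bot at_bot"
  have car: "carrier QI_plus = {qi_rel `` {f} | f. ?P f}" by (simp add: QI_plus_def)
  show ?thesis
  proof (rule subgroupI)
    show "carrier QI_plus \<subseteq> carrier QI" by (auto simp: car intro: qi_rel_classI)
    have "?P id" by (simp add: quasi_isometry_id filterlim_ident id_def[symmetric])
                    (simp add: id_def filterlim_ident)
    then show "carrier QI_plus \<noteq> {}" unfolding car by blast
  next
    fix a assume "a \<in> carrier QI_plus"
    then obtain f where f: "?P f" "a = qi_rel `` {f}" by (auto simp: car)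
    obtain g where g: "quasi_isometry g" "(g \<circ> f, id) \<in> qi_rel" "(f \<circ> g, id) \<in> qi_rel"
      using quasi_inverse f(1) by blast
    have "inv\<^bsub>QI\<^esub> a = qi_rel `` {g}"
      using f g equiv_class_eq[OF equiv_qi_rel g(2)]
      by (intro inv_equality) (auto simp: qi_mult_class QI_def[THEN arg_cong[of _ _ one]] intro: qi_rel_classI)
    moreover have "?P g" using g f quasi_inverse_orientation[OF _ g(3)] by auto
    ultimately show "inv\<^bsub>QI\<^esub> a \<in> carrier QI_plus" by (auto simp: car)
  next
    fix a b assume "a \<in> carrier QI_plus" "b \<in> carrier QI_plus"
    then obtain f g where *: "?P f" "a = qi_rel `` {f}" "?P g" "b = qi_rel `` {g}"
      by (auto simp: car)
    moreover from this have "filterlim (f \<circ> g) at_top at_top" "filterlim (f \<circ> g) at_bot at_bot"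
      unfolding comp_def by (blast intro: filterlim_compose)+
    ultimately have "?P (f \<circ> g)" by (simp add: quasi_isometry_comp)
    with * show "a \<otimes>\<^bsub>QI\<^esub> b \<in> carrier QI_plus" by (auto simp: car qi_mult_class)
  qed
qed

lemma group_QI_plus: "group QI_plus"
proof -
  have "QI_plus = QI\<lparr>carrier := carrier QI_plus\<rparr>" by (simp add: QI_plus_def)
  then show ?thesis
    using group.subgroup_imp_group[OF group_QI subgroup_QI_plus] by simp
qed

lemma group_Homeo: "group (Homeo :: ('a::topological_space \<Rightarrow> 'a) monoid)"
proof (rule groupI)
  show "\<exists>y\<in>carrier Homeo. y \<otimes>\<^bsub>Homeo\<^esub> x = \<one>\<^bsub>Homeo\<^esub>"
    if x: "x \<in> carrier Homeo" for x :: "'a \<Rightarrow> 'a"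
  proof -
    obtain k where "homeomorphism UNIV UNIV x k" using x by (auto simp: Homeo_def)
    then show ?thesis
      by (intro bexI[of _ k]) (auto simp: Homeo_def homeomorphism_def fun_eq_iff)
  qed
qed (auto simp: Homeo_def comp_assoc id_def intro: homeomorphism_compose homeomorphism_ident)

end

theory Submission
  imports Defs
begin

text \<open>
Fix an injective homomorphism from the orientation-preserving quasi-isometry group of the line to
the homeomorphism group of the line, and let the group act through it. For a set \<open>Y\<close> of reals
consider the increasing homeomorphisms with bilipschitz constant 2 that are the identity off
\<open>Y\<close>. Some of them represent nontrivial classes if \<open>Y\<close> is thick, that is, contains arbitrarily
long intervals arbitrarily far to the right. The uniform constant makes it possible to multiply
infinitely many such maps with disjoint supports, and for every decreasing sequence of thick sets
there is a thick set that is contained in each of them up to a bounded set (\<open>thick_pseudo_intersection\<close>). The proof shows that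
every point \<open>x\<close> of the line is fixed by all maps supported in some thick set, which can be chosen
inside any prescribed small enough thick set (\<open>thick_fixing_point\<close>). Diagonalising over the
rational points then gives a thick set all of whose maps act trivially, against injectivity
(\<open>inconsistent\<close>).

To find a thick set fixing \<open>x\<close>, shrink \<open>Y\<close> until the supremum and the infimum of the images of
\<open>x\<close> under the maps supported in \<open>Y\<close> no longer change when \<open>Y\<close> is replaced by a thick subset; a
countable descent is enough because they are extended real numbers (\<open>stabilise\<close>). Suppose that \<open>x\<close> is
still moved, and let \<open>I\<close> be the open interval between the infimum and the supremum. Since maps
with disjoint supports commute and may be multiplied, \<open>I\<close> is invariant under maps whose support
leaves a thick part of \<open>Y\<close> free, and every thick subset of \<open>Y\<close> carries a map that pushes a given
point of \<open>I\<close> past another given one. Split \<open>Y\<close> into disjoint thick sets \<open>Z n\<close>. A swindle gives on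
each \<open>Z n\<close> a fixed map \<open>s n\<close> such that every map \<open>c n\<close> supported in a certain thick subset of
\<open>Z n\<close> is a commutator of \<open>s n\<close> with some \<open>g n\<close> (\<open>swindle\<close>). Let \<open>(p n, q n)\<close> run through the
rational intervals, choose \<open>c n\<close> so far-pushing, relative to \<open>p n\<close>, \<open>q n\<close> and \<open>s n\<close>, that
no map whose commutator with \<open>s n\<close> is \<open>c n\<close> can send \<open>x\<close> into \<open>(p n, q n)\<close>, and let \<open>F\<close> be the
product of all \<open>g n\<close>. The commutator of \<open>F\<close> with \<open>s n\<close> is still \<open>c n\<close>, so \<open>F\<close> cannot send \<open>x\<close>
into any \<open>(p n, q n)\<close> with end points in \<open>I\<close>. But \<open>F\<close> sends \<open>x\<close> into \<open>I\<close>, which these intervals cover (\<open>stable_point_fixed\<close>).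
\<close>

section \<open>Bilipschitz maps with prescribed support\<close>

text \<open>The constant is the same for all maps because an infinite product of maps with disjoint supports
and unbounded constants need not be a quasi-isometry. The price is that a composite of two such
maps can have a larger constant; products are formed only where the supports are disjoint.\<close>

definition bilip_on :: "real set \<Rightarrow> (real \<Rightarrow> real) set" where
  "bilip_on Y = {f. (\<forall>a b. a \<le> b \<longrightarrow> (b - a) / 2 \<le> f b - f a \<and> f b - f a \<le> 2 * (b - a)) \<and>
                    (\<forall>z. z \<notin> Y \<longrightarrow> f z = z)}"

lemma bilip_onI:
  assumes "\<And>a b. a \<le> b \<Longrightarrow> (b - a) / 2 \<le> f b - f a \<and> f b - f a \<le> 2 * (b - a)"
    and "\<And>z. z \<notin> Y \<Longrightarrow> f z = z"
  shows "f \<in> bilip_on Y"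
  using assms by (simp add: bilip_on_def)

lemma bilip_onD:
  assumes "f \<in> bilip_on Y"
  shows "a \<le> b \<Longrightarrow> (b - a) / 2 \<le> f b - f a" "a \<le> b \<Longrightarrow> f b - f a \<le> 2 * (b - a)"
    "z \<notin> Y \<Longrightarrow> f z = z"
  using assms by (auto simp: bilip_on_def)

lemma bilip_on_mono: "f \<in> bilip_on Y \<Longrightarrow> Y \<subseteq> Z \<Longrightarrow> f \<in> bilip_on Z"
  by (auto simp: bilip_on_def)

lemma id_in_bilip_on: "id \<in> bilip_on Y"
  by (auto simp: bilip_on_def)

lemma bilip_on_dist:
  assumes "f \<in> bilip_on Y"
  shows "dist a b / 2 \<le> dist (f a) (f b)" "dist (f a) (f b) \<le> 2 * dist a b"
  using bilip_onD(1,2)[OF assms, of a b] bilip_onD(1,2)[OF assms, of b a]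
  unfolding dist_real_def by argo+

lemma bilip_on_strict_mono: "f \<in> bilip_on Y \<Longrightarrow> a < b \<Longrightarrow> f a < f b"
  using bilip_onD(1)[of f Y a b] by simp

lemma bilip_on_inj: "f \<in> bilip_on Y \<Longrightarrow> f a = f b \<Longrightarrow> a = b"
  using bilip_on_strict_mono[of f Y a b] bilip_on_strict_mono[of f Y b a] by linarith

lemma bilip_on_continuous:
  assumes "f \<in> bilip_on Y"
  shows "continuous_on S f"
proof -
  have "2-lipschitz_on S f"
    using bilip_on_dist(2)[OF assms] by (intro lipschitz_onI) auto
  then show ?thesis by (rule lipschitz_on_continuous_on)
qed

lemma bilip_on_surj:
  assumes "f \<in> bilip_on Y"
  shows "surj f"
proof -
  have "\<exists>x. f x = y" for y
  proof -
    define r where "r = 2 * \<bar>y - f 0\<bar>"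
    have "f (- r) \<le> y" using bilip_onD(1)[OF assms, of "- r" 0] by (simp add: r_def)
    moreover have "y \<le> f r" using bilip_onD(1)[OF assms, of 0 r] by (simp add: r_def)
    ultimately show ?thesis
      using IVT'[of f "- r" y r] bilip_on_continuous[OF assms] by (force simp: r_def)
  qed
  then show ?thesis by (metis surjI)
qed

lemma bilip_on_inverse:
  assumes "f \<in> bilip_on Y"
  obtains g where "g \<in> bilip_on Y" "f \<circ> g = id" "g \<circ> f = id"
proof -
  define g where "g = inv_into UNIV f"
  have fg: "f (g y) = y" for y
    unfolding g_def using bilip_on_surj[OF assms] by (rule surj_f_inv_f)
  have gf: "g (f y) = y" for y using bilip_on_inj[OF assms] fg by blast
  show ?thesis
  proof
    show "g \<in> bilip_on Y"
    proof (rule bilip_onI)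
      fix a b :: real assume "a \<le> b"
      then have "g a \<le> g b"
        using bilip_on_strict_mono[OF assms, of "g b" "g a"] fg by fastforce
      then show "(b - a) / 2 \<le> g b - g a \<and> g b - g a \<le> 2 * (b - a)"
        using bilip_onD(1,2)[OF assms, of "g a" "g b"] fg by simp
    qed (metis assms bilip_onD(3) gf)
  qed (use fg gf in auto)
qed

lemma bilip_on_image_iff: "f \<in> bilip_on Y \<Longrightarrow> f z \<in> Y \<longleftrightarrow> z \<in> Y"
  using bilip_onD(3) bilip_on_inj by metis

lemma bilip_on_disjoint_commute:
  assumes "f \<in> bilip_on Y" "g \<in> bilip_on Z" "Y \<inter> Z = {}"
  shows "f (g z) = g (f z)"
  using bilip_on_image_iff[OF assms(1), of z] bilip_on_image_iff[OF assms(2), of z]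
    bilip_onD(3)[OF assms(1)] bilip_onD(3)[OF assms(2)] assms(3)
  by (metis IntI empty_iff)

text \<open>For two points carried by different members of the family there is a point between them that the
whole family fixes: the first fixed point, to the right of the left one, of the member that moves
it. The other members are the identity up to there, hence by continuity also at that point. The
estimate is then the sum of the estimates on the two sides.\<close>

lemma bilip_on_glue:
  fixes f :: "'i \<Rightarrow> real \<Rightarrow> real"
  assumes f: "\<And>i. f i \<in> bilip_on (Y i)"
    and disj: "\<And>i j. i \<noteq> j \<Longrightarrow> Y i \<inter> Y j = {}"
  obtains F where "F \<in> bilip_on (\<Union>i. Y i)" "\<And>i z. z \<in> Y i \<Longrightarrow> F z = f i z"
proof
  define F where "F z = (if z \<in> (\<Union>i. Y i) then f (THE i. z \<in> Y i) z else z)" for z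
  show on: "F z = f i z" if "z \<in> Y i" for i z
  proof -
    have "(THE i. z \<in> Y i) = i" using that disj by (intro the_equality) auto
    then show ?thesis using that by (auto simp: F_def)
  qed
  have off: "F z = z" if "\<And>j. f j z = z" for z
    using that on[of z] by (cases "z \<in> (\<Union>i. Y i)") (auto simp: F_def)
  have common_fixpoint: "\<exists>z. a \<le> z \<and> z \<le> b \<and> (\<forall>j. f j z = z)" if a: "a \<in> Y i" "a \<le> b" "b \<notin> Y i" for a b i
  proof -
    define C where "C = {z \<in> {a..b}. f i z = z}"
    have "closed C" unfolding C_def
      by (intro continuous_closed_preimage_constant[of _ "\<lambda>z. f i z - z" 0, simplified]
          continuous_on_diff bilip_on_continuous[OF f] continuous_on_id) auto
    moreover have "b \<in> C" using that bilip_onD(3)[OF f] by (auto simp: C_def)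
    moreover have bdd: "bdd_below C" by (auto simp: C_def intro!: bdd_belowI[of _ a])
    ultimately have z: "Inf C \<in> C" by (intro closed_contains_Inf) auto
    have "f j (Inf C) = Inf C" for j
    proof (cases "j = i \<or> Inf C = a")
      case True
      then show ?thesis using z a disj[of i j] bilip_onD(3)[OF f, of a j]
        by (cases "j = i") (auto simp: C_def)
    next
      case False
      have "f j w - w = 0" if "w \<in> {a<..<Inf C}" for w
      proof -
        have "w \<notin> C" using that bdd cInf_lower[of w C] by auto
        then have "f i w \<noteq> w" using that z by (auto simp: C_def)
        then have "w \<in> Y i" using bilip_onD(3)[OF f] by blast
        then show ?thesis using False disj[of i j] bilip_onD(3)[OF f, of w j] by auto
      qed
      then have "f j w - w = 0" if "w \<in> closure {a<..<Inf C}" for w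
        by (rule continuous_constant_on_closure[rotated])
           (use that in \<open>auto intro!: continuous_on_diff bilip_on_continuous[OF f]\<close>)
      moreover have "Inf C \<in> closure {a<..<Inf C}"
        using False z by (auto simp: C_def)
      ultimately show ?thesis by force
    qed
    then show ?thesis using z by (auto simp: C_def)
  qed
  show "F \<in> bilip_on (\<Union>i. Y i)"
  proof (rule bilip_onI)
    fix a b :: real assume ab: "a \<le> b"
    have R: "(b - c) / 2 \<le> F b - F c \<and> F b - F c \<le> 2 * (b - c)"
      if "c \<le> b" "\<And>j. f j c = c" for c
    proof (cases "b \<in> (\<Union>i. Y i)")
      case True
      then obtain j where "b \<in> Y j" by blast
      then show ?thesis
        using bilip_onD(1,2)[OF f[of j], of c b] on[of b j] off[of c] that by auto
    qed (use that off[of c] in \<open>auto simp: F_def\<close>)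
    show "(b - a) / 2 \<le> F b - F a \<and> F b - F a \<le> 2 * (b - a)"
    proof (cases "a \<in> (\<Union>i. Y i)")
      case True
      then obtain i where i: "a \<in> Y i" by blast
      show ?thesis
      proof (cases "b \<in> Y i")
        case True
        then show ?thesis using i on[of _ i] bilip_onD(1,2)[OF f[of i] ab] by auto
      next
        case False
        then obtain z where z: "a \<le> z" "z \<le> b" "\<And>j. f j z = z" using common_fixpoint[OF i ab] by blast
        have "(z - a) / 2 \<le> z - F a \<and> z - F a \<le> 2 * (z - a)"
          using bilip_onD(1,2)[OF f[of i] z(1)] on[OF i] z(3)[of i] by simp
        then show ?thesis using R[OF z(2,3)] off[OF z(3)] by argo
      qed
    next
      case False
      then show ?thesis using R[OF ab] bilip_onD(3)[OF f] by blast
    qed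
  qed (simp add: F_def)
qed

lemma bilip_on_comp_disjoint:
  assumes "f \<in> bilip_on Y" "g \<in> bilip_on Z" "Y \<inter> Z = {}"
  shows "f \<circ> g \<in> bilip_on (Y \<union> Z)"
proof -
  obtain F where F: "F \<in> bilip_on (\<Union>i. if i then Y else Z)"
    "\<And>i z. z \<in> (if i then Y else Z) \<Longrightarrow> F z = (if i then f else g) z"
  proof (rule bilip_on_glue[of "\<lambda>i. if i then f else g" "\<lambda>i. if i then Y else Z"])
    show "(if i then Y else Z) \<inter> (if j then Y else Z) = {}" if "i \<noteq> j" for i j
      using that assms(3) by auto
  qed (use assms in \<open>auto split: if_splits\<close>)
  have un: "(\<Union>i. if i then Y else Z) = Y \<union> Z" by (auto split: if_splits)
  have "(f \<circ> g) z = F z" for z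
  proof (cases "z \<in> Y")
    case True
    then have "g z = z" using assms by (auto intro: bilip_onD(3))
    then show ?thesis using F(2)[of z True] True by simp
  next
    case False
    then have fz: "f z = z" using assms by (auto intro: bilip_onD(3))
    have "f (g z) = g z" using bilip_on_disjoint_commute[OF assms, of z] fz by simp
    moreover have "F z = g z"
      using F(2)[of z False] bilip_onD(3)[OF F(1), of z] bilip_onD(3)[OF assms(2), of z] False
      by (cases "z \<in> Z") (auto simp: un)
    ultimately show ?thesis by simp
  qed
  then have "f \<circ> g = F" by blast
  with F(1) un show ?thesis by simp
qed

text \<open>A segment that leaves \<open>V\<close> crosses the frontier, where both maps agree with the identity.\<close>

lemma bilip_on_restrict:
  assumes f: "f \<in> bilip_on Y" and fr: "\<And>z. z \<in> frontier V \<Longrightarrow> f z = z"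
  shows "(\<lambda>z. if z \<in> V then f z else z) \<in> bilip_on (Y \<inter> V)"
proof (rule bilip_onI)
  fix a b :: real assume ab: "a \<le> b"
  show "(b - a) / 2 \<le> (if b \<in> V then f b else b) - (if a \<in> V then f a else a) \<and>
        (if b \<in> V then f b else b) - (if a \<in> V then f a else a) \<le> 2 * (b - a)"
  proof (cases "(a \<in> V) = (b \<in> V)")
    case True
    then show ?thesis using bilip_onD(1,2)[OF f ab] ab by auto
  next
    case False
    then have "{a..b} \<inter> frontier V \<noteq> {}"
      using ab by (intro connected_Int_frontier) auto
    then obtain z where z: "z \<in> {a..b}" "z \<in> frontier V" by blast
    then have "a \<le> z" "z \<le> b" "f z = z" using fr[OF z(2)] by auto
    then show ?thesis
      using bilip_onD(1,2)[OF f, of a z] bilip_onD(1,2)[OF f, of z b] False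
      by (auto split: if_splits)
  qed
qed (use f in \<open>auto intro: bilip_onD(3)\<close>)

text \<open>Conjugation by a homothety preserves the bilipschitz constant. This keeps the infinitely many
shrunken copies in the swindle uniformly bilipschitz.\<close>

lemma bilip_on_rescale:
  assumes f: "f \<in> bilip_on Y" and m: "m > 0"
  shows "(\<lambda>z. a + (f (a + m * (z - a)) - a) / m) \<in> bilip_on {z. a + m * (z - a) \<in> Y}"
proof (rule bilip_onI)
  fix u v :: real assume uv: "u \<le> v"
  then have *: "a + m * (u - a) \<le> a + m * (v - a)" using m by simp
  define d where "d = f (a + m * (v - a)) - f (a + m * (u - a))"
  have "m * (v - u) / 2 \<le> d" "d \<le> 2 * (m * (v - u))"
    using bilip_onD(1,2)[OF f *] by (simp_all add: d_def algebra_simps)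
  then have "(v - u) / 2 \<le> d / m" "d / m \<le> 2 * (v - u)"
    using m by (simp_all add: field_simps)
  moreover have "d / m = (a + (f (a + m * (v - a)) - a) / m) - (a + (f (a + m * (u - a)) - a) / m)"
    by (simp add: d_def diff_divide_distrib)
  ultimately show "(v - u) / 2 \<le> (a + (f (a + m * (v - a)) - a) / m) - (a + (f (a + m * (u - a)) - a) / m) \<and>
    (a + (f (a + m * (v - a)) - a) / m) - (a + (f (a + m * (u - a)) - a) / m) \<le> 2 * (v - u)"
    by simp
qed (use bilip_onD(3)[OF f] m in auto)

section \<open>Thick sets\<close>

definition thick :: "real set \<Rightarrow> bool" where
  "thick Y \<longleftrightarrow> (\<forall>L. \<exists>a\<ge>L. {a<..<a + L} \<subseteq> Y)"

lemma thick_UNIV: "thick UNIV"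
  by (auto simp: thick_def)

lemma thick_tail:
  assumes "thick Y"
  shows "thick (Y \<inter> {R<..})"
  unfolding thick_def
proof
  fix L
  obtain a where "a \<ge> max L R" "{a<..<a + max L R} \<subseteq> Y"
    using assms unfolding thick_def by blast
  then show "\<exists>a\<ge>L. {a<..<a + L} \<subseteq> Y \<inter> {R<..}"
    by (intro exI[of _ a]) (auto simp: subset_iff)
qed

text \<open>The bound \<open>real k \<le> a k\<close> makes the intervals leave every bounded set.\<close>

lemma thick_diagonal_intervals:
  fixes Y :: "nat \<Rightarrow> real set"
  assumes "\<And>k. thick (Y k)"
  obtains a :: "nat \<Rightarrow> real" where "\<And>k. {a k<..<a k + k} \<subseteq> Y k"
    "\<And>k. real k \<le> a k" "\<And>i j. i < j \<Longrightarrow> a i + i \<le> a j"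
proof -
  have "\<exists>a. \<forall>k. ({a k<..<a k + k} \<subseteq> Y k \<and> real k \<le> a k) \<and> a k + k \<le> a (Suc k)"
  proof (rule dependent_nat_choice)
    show "\<exists>a. {a<..<a + real 0} \<subseteq> Y 0 \<and> real 0 \<le> a" by (rule exI[of _ 0]) simp
  next
    fix x n
    define M where "M = max (Suc n) (x + real n)"
    obtain a where "a \<ge> M" "{a<..<a + M} \<subseteq> Y (Suc n)"
      using assms[of "Suc n"] unfolding thick_def by blast
    then show "\<exists>y. ({y<..<y + real (Suc n)} \<subseteq> Y (Suc n) \<and> real (Suc n) \<le> y) \<and> x + real n \<le> y"
      by (intro exI[of _ a]) (auto simp: subset_iff M_def)
  qed
  then obtain a where a: "\<And>k. {a k<..<a k + k} \<subseteq> Y k" "\<And>k. real k \<le> a k"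
    "\<And>k. a k + k \<le> a (Suc k)" by blast
  have "a i + i \<le> a j" if "i < j" for i j
    using that
  proof (induction j)
    case (Suc j)
    then show ?case using a(3)[of j] by (cases "i = j") auto
  qed simp
  with a show ?thesis using that by blast
qed

lemma intervals_disjoint:
  fixes a :: "nat \<Rightarrow> real"
  assumes "\<And>i j. i < j \<Longrightarrow> a i + i \<le> a j" "i \<noteq> j"
  shows "{a i<..<a i + i} \<inter> {a j<..<a j + j} = {}"
  using assms(1)[of i j] assms(1)[of j i] assms(2) by (cases "i < j") auto

lemma thick_UN_intervals:
  fixes a :: "nat \<Rightarrow> real" and e :: "nat \<Rightarrow> nat"
  assumes "\<And>k. real k \<le> a k" "\<And>j. j \<le> e j"
  shows "thick (\<Union>j. {a (e j)<..<a (e j) + e j})"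
  unfolding thick_def
proof
  fix L :: real
  obtain j :: nat where j: "L \<le> j" using real_arch_simple by blast
  then have "L \<le> e j" "L \<le> a (e j)"
    using assms(2)[of j] assms(1)[of "e j"] by linarith+
  then show "\<exists>b\<ge>L. {b<..<b + L} \<subseteq> (\<Union>j. {a (e j)<..<a (e j) + e j})"
    by (intro exI[of _ "a (e j)"]) (auto intro!: exI[of _ j])
qed

text \<open>A sequence of intervals with growing lengths is distributed over countably many subsequences by a
pairing function; the interval of index \<open>prod_encode (n, j)\<close> has length at least \<open>j\<close>.\<close>

lemma thick_split:
  assumes "thick Y"
  obtains Z :: "nat \<Rightarrow> real set" where "\<And>n. thick (Z n)" "\<And>n. Z n \<subseteq> Y"
    "\<And>m n. m \<noteq> n \<Longrightarrow> Z m \<inter> Z n = {}"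
proof -
  obtain a where a: "\<And>k. {a k<..<a k + real k} \<subseteq> Y" "\<And>k. real k \<le> a k"
    "\<And>i j. i < j \<Longrightarrow> a i + real i \<le> a j"
    using thick_diagonal_intervals[of "\<lambda>_. Y"] assms by blast
  define e where "e n j = prod_encode (n, j)" for n j :: nat
  show ?thesis
  proof (rule that[of "\<lambda>n. \<Union>j. {a (e n j)<..<a (e n j) + e n j}"])
    show "thick (\<Union>j. {a (e n j)<..<a (e n j) + e n j})" for n
      by (rule thick_UN_intervals[OF a(2)]) (simp add: e_def le_prod_encode_2)
    show "(\<Union>j. {a (e n j)<..<a (e n j) + e n j}) \<subseteq> Y" for n using a(1) by blast
    show "(\<Union>j. {a (e m j)<..<a (e m j) + e m j}) \<inter> (\<Union>j. {a (e n j)<..<a (e n j) + e n j}) = {}"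
      if "m \<noteq> n" for m n
    proof -
      have "e m i \<noteq> e n j" for i j using that by (simp add: e_def)
      then show ?thesis using intervals_disjoint[of a, OF a(3)] by blast
    qed
  qed
qed

text \<open>The diagonal union of intervals taken from the successive sets is contained in each of them up to
finitely many intervals. The point \<open>R\<close> outside \<open>Z\<close> is a place at which every map supported in \<open>Z\<close>
can be cut.\<close>

lemma thick_pseudo_intersection:
  fixes Y :: "nat \<Rightarrow> real set"
  assumes "\<And>n. thick (Y n)" "\<And>n. Y (Suc n) \<subseteq> Y n"
  obtains Z where "thick Z" "Z \<subseteq> Y 0" "Z \<subseteq> {0<..}" "\<And>n. \<exists>R. R \<notin> Z \<and> Z \<inter> {R<..} \<subseteq> Y n"
proof -
  obtain a where a: "\<And>k. {a k<..<a k + real k} \<subseteq> Y k" "\<And>k. real k \<le> a k"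
    "\<And>i j. i < j \<Longrightarrow> a i + real i \<le> a j"
    using thick_diagonal_intervals[of Y] assms by blast
  have dec: "Y n \<subseteq> Y m" if "m \<le> n" for m n
    using that lift_Suc_antimono_le[of Y] assms(2) by blast
  show ?thesis
  proof (rule that[of "\<Union>k. {a k<..<a k + real k}"])
    show "thick (\<Union>k. {a k<..<a k + real k})"
      using thick_UN_intervals[of a id] a(2) by simp
    show "(\<Union>k. {a k<..<a k + real k}) \<subseteq> Y 0" using a(1) dec by blast
    show "(\<Union>k. {a k<..<a k + real k}) \<subseteq> {0<..}"
    proof -
      have "{a k<..<a k + real k} \<subseteq> {0<..}" for k
        using a(2)[of k] of_nat_0_le_iff[of k, where ?'a = real] by (auto simp del: of_nat_0_le_iff)
      then show ?thesis by blast
    qed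
    fix n
    have "a n \<notin> {a k<..<a k + real k}" for k
      using a(3)[of k n] a(3)[of n k] by (cases k n rule: linorder_cases) auto
    moreover have "{a k<..<a k + real k} \<inter> {a n<..} \<subseteq> Y n" for k
      using a(3)[of k n] a(1)[of k] dec[of n k] by (cases "k < n") auto
    ultimately show "\<exists>R. R \<notin> (\<Union>k. {a k<..<a k + real k}) \<and>
        (\<Union>k. {a k<..<a k + real k}) \<inter> {R<..} \<subseteq> Y n"
      by (intro exI[of _ "a n"]) blast
  qed
qed


section \<open>Commutator swindle\<close>

text \<open>The increasing piecewise linear bijection of \<open>{a..a + L}\<close> that maps the midpoint to the first
quarter point, with slopes 1/2 and 3/2. On the left half it is the homothety of centre \<open>a\<close> and
ratio 1/2.\<close>

definition contract :: "real \<Rightarrow> real \<Rightarrow> real \<Rightarrow> real" where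
  "contract a L z =
     (if z \<in> {a<..<a + L} then max (a + (z - a) / 2) (a + (3 * (z - a) - L) / 2) else z)"

lemma contract_bilip_on: "contract a L \<in> bilip_on {a<..<a + L}"
proof (rule bilip_onI)
  fix u v :: real assume "u \<le> v"
  then show "(v - u) / 2 \<le> contract a L v - contract a L u \<and>
      contract a L v - contract a L u \<le> 2 * (v - u)"
    by (simp add: contract_def max_def) argo
qed (auto simp: contract_def)

lemma bilip_on_fixes_interval:
  assumes "f \<in> bilip_on Y" "f p = p" "f q = q" "z \<in> {p<..<q}"
  shows "f z \<in> {p<..<q}"
  using bilip_on_strict_mono[OF assms(1), of p z] bilip_on_strict_mono[OF assms(1), of z q] assms
  by auto

text \<open>The images of the second quarter of \<open>{a<..<a + L}\<close> under the iterates of \<open>contract a L\<close>.\<close>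

definition piece :: "real \<Rightarrow> real \<Rightarrow> nat \<Rightarrow> real set" where
  "piece a L i = {a + L / 2 ^ (i + 2)<..<a + L / 2 ^ (i + 1)}"

lemma contract_piece:
  assumes "z \<in> {a<..<a + L}" "z \<le> a + L / 2"
  shows "contract a L z = a + (z - a) / 2"
  using assms by (auto simp: contract_def max_def)

lemma piece_rescale: "a + 2 ^ i * (z - a) \<in> piece a L 0 \<longleftrightarrow> z \<in> piece a L i"
  by (auto simp: piece_def field_simps power_add)

lemma piece_half: "a + (z - a) / 2 \<in> piece a L (Suc i) \<longleftrightarrow> z \<in> piece a L i"
  by (auto simp: piece_def field_simps)

lemma piece_subset:
  assumes "L \<ge> 0"
  shows "piece a L i \<subseteq> {a<..<a + L}" "piece a L i \<subseteq> {..<a + L / 2}"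
proof -
  have 1: "L / 2 ^ (i + 1) \<le> L / 2 ^ 1"
    using assms by (intro divide_left_mono power_increasing) auto
  have 2: "0 \<le> L / 2 ^ (i + 2)" using assms by simp
  have "x \<in> {a<..<a + L} \<and> x < a + L / 2" if "x \<in> piece a L i" for x
  proof -
    have "a + L / 2 ^ (i + 2) < x" "x < a + L / 2 ^ (i + 1)"
      using that unfolding piece_def by simp_all
    moreover have "L / 2 ^ 1 = L / 2" by simp
    ultimately have "a < x" "x < a + L / 2" using 1 2 by argo+
    then show ?thesis using assms by auto
  qed
  then show "piece a L i \<subseteq> {a<..<a + L}" "piece a L i \<subseteq> {..<a + L / 2}"
    by blast+
qed

lemma piece_disjoint:
  assumes "L \<ge> 0" "i \<noteq> j"
  shows "piece a L i \<inter> piece a L j = {}"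
proof -
  have *: "piece a L i \<inter> piece a L j = {}" if "i < j" for i j
  proof -
    have "L / 2 ^ (j + 1) \<le> L / 2 ^ (i + 2)"
      using that assms by (intro divide_left_mono power_increasing) auto
    then show ?thesis by (auto simp: piece_def)
  qed
  show ?thesis using *[of i j] *[of j i] assms(2) by (cases "i < j") auto
qed

text \<open>Let \<open>s\<close> contract each of a sequence of intervals in \<open>Z\<close>, and let \<open>Z'\<close> consist of their second
quarters. The iterates of \<open>s\<close> carry \<open>Z'\<close> to pairwise disjoint sets, so that \<open>g\<close> can be taken to be
the infinite product of the conjugates of \<open>c\<close> by \<open>s ^^ i\<close>, \<open>i \<ge> 0\<close>. Conjugating \<open>g\<close> by \<open>s\<close> removes
exactly the factor \<open>c\<close>, that is, \<open>g = c \<circ> (s \<circ> g \<circ> s\<^sup>-\<^sup>1)\<close>. What matters later is that \<open>s\<close> does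
not depend on \<open>c\<close>.\<close>

lemma swindle:
  assumes "thick Z"
  obtains s Z' where "s \<in> bilip_on Z" "\<And>B. \<exists>z. B < dist (s z) z"
    "thick Z'" "Z' \<subseteq> Z"
    "\<And>c. c \<in> bilip_on Z' \<Longrightarrow> \<exists>g\<in>bilip_on Z. g \<circ> s = c \<circ> s \<circ> g"
proof -
  obtain a where a: "\<And>k. {a k<..<a k + real k} \<subseteq> Z" "\<And>k. real k \<le> a k"
    "\<And>i j. i < j \<Longrightarrow> a i + real i \<le> a j"
    using thick_diagonal_intervals[of "\<lambda>_. Z"] assms by blast
  define U where "U k = {a k<..<a k + real k}" for k
  define P where "P k i = piece (a k) (real k) i" for k i
  define Z' where "Z' = (\<Union>k. P k 0)"
  have U_disj: "U i \<inter> U j = {}" if "i \<noteq> j" for i j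
    unfolding U_def by (rule intervals_disjoint[of a, OF a(3) that])
  have PU: "P k i \<subseteq> U k" for k i unfolding P_def U_def by (rule piece_subset) simp
  have P_eq: "k = l \<and> i = j" if "z \<in> P k i" "z \<in> P l j" for k l i j z
    using that PU[of k i] PU[of l j] U_disj[of k l] piece_disjoint[of "real k" i j "a k"]
    by (cases "k = l") (auto simp: P_def)
  obtain s where s: "s \<in> bilip_on (\<Union>k. U k)"
      "\<And>k z. z \<in> U k \<Longrightarrow> s z = contract (a k) (real k) z"
    using bilip_on_glue[of "\<lambda>k. contract (a k) (real k)" U] contract_bilip_on U_disj
    by (metis U_def)
  have sU: "s z \<in> U k" if "z \<in> U k" for z k
  proof -
    have "a k \<notin> U l \<and> a k + real k \<notin> U l" for l
      using a(3)[of k l] a(3)[of l k] by (cases k l rule: linorder_cases) (auto simp: U_def)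
    then have "s (a k) = a k" "s (a k + real k) = a k + real k"
      using bilip_onD(3)[OF s(1)] by blast+
    then show ?thesis using bilip_on_fixes_interval[OF s(1)] that by (simp add: U_def)
  qed
  have s_half: "s z = a k + (z - a k) / 2" if "z \<in> U k" "z \<le> a k + real k / 2" for z k
    using that s(2)[of z k] contract_piece by (simp add: U_def)
  show ?thesis
  proof
    show "s \<in> bilip_on Z" by (rule bilip_on_mono[OF s(1)]) (use a(1) in \<open>auto simp: U_def\<close>)
    show "\<exists>z. B < dist (s z) z" for B
    proof -
      obtain k where k: "4 * max B 1 < real k" using reals_Archimedean2 by blast
      then have "s (a k + real k / 2) = a k + real k / 4"
        using s_half[of "a k + real k / 2" k] by (simp add: U_def)
      then show ?thesis
        using k by (intro exI[of _ "a k + real k / 2"]) (simp add: dist_real_def)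
    qed
    show "thick Z'" unfolding thick_def
    proof
      fix L
      obtain k where k: "4 * max L 1 \<le> real k" using real_arch_simple by blast
      then have "{a k + real k / 4<..<a k + real k / 4 + L} \<subseteq> P k 0"
        by (auto simp: P_def piece_def)
      then show "\<exists>b\<ge>L. {b<..<b + L} \<subseteq> Z'"
        using k a(2)[of k] by (intro exI[of _ "a k + real k / 4"]) (auto simp: Z'_def)
    qed
    show "Z' \<subseteq> Z" using PU a(1) unfolding Z'_def U_def by blast
    fix c assume c: "c \<in> bilip_on Z'"
    \<comment> \<open>The conjugate by the \<open>i\<close>-th iterate of \<open>s\<close> of the part of \<open>c\<close> in the \<open>k\<close>-th interval.\<close>
    define h where "h = (\<lambda>(k, i) z. a k +
      ((let w = a k + 2 ^ i * (z - a k) in if w \<in> P k 0 then c w else w) - a k) / 2 ^ i)"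
    have P0: "P k 0 = {a k + real k / 4<..<a k + real k / 2}" for k
      by (simp add: P_def piece_def)
    have frontier_P0: "frontier (P k 0) = {a k + real k / 4, a k + real k / 2}" if "k \<noteq> 0" for k
      using that by (auto simp: P0 frontier_def)
    have ends: "c z = z" if "z \<in> frontier (P k 0)" for z k
    proof -
      have "P k 0 \<noteq> {}" using that by auto
      then have "k \<noteq> 0" by (auto simp: P0)
      then have z: "z = a k + real k / 4 \<or> z = a k + real k / 2" "real k \<noteq> 0"
        using that frontier_P0 by auto
      then have "z \<in> U k" by (auto simp: U_def)
      then have "z \<notin> P l 0" for l
        using z PU[of l 0] U_disj[of k l] by (cases "k = l") (auto simp: P_def piece_def)
      then show ?thesis using bilip_onD(3)[OF c] by (auto simp: Z'_def)
    qed
    have h: "h (k, i) \<in> bilip_on (P k i)" for k i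
    proof -
      have "(\<lambda>w. if w \<in> P k 0 then c w else w) \<in> bilip_on (Z' \<inter> P k 0)"
        by (rule bilip_on_restrict[OF c ends])
      then have "h (k, i) \<in> bilip_on {z. a k + 2 ^ i * (z - a k) \<in> Z' \<inter> P k 0}"
        unfolding h_def Let_def prod.case by (rule bilip_on_rescale) simp
      then show ?thesis
        by (rule bilip_on_mono) (auto simp: P_def piece_rescale)
    qed
    obtain g where g: "g \<in> bilip_on (\<Union>ki. P (fst ki) (snd ki))"
        "\<And>ki z. z \<in> P (fst ki) (snd ki) \<Longrightarrow> g z = h ki z"
    proof (rule bilip_on_glue[of h "\<lambda>ki. P (fst ki) (snd ki)"])
      show "h ki \<in> bilip_on (P (fst ki) (snd ki))" for ki using h[of "fst ki" "snd ki"] by simp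
      show "P (fst x) (snd x) \<inter> P (fst y) (snd y) = {}" if "x \<noteq> y" for x y
        using that P_eq[of _ "fst x" "snd x" "fst y" "snd y"] by (auto simp: prod_eq_iff)
    qed auto
    have gP: "g z = a k + (c (a k + 2 ^ i * (z - a k)) - a k) / 2 ^ i" if "z \<in> P k i" for z k i
      using g(2)[of z "(k, i)"] that by (simp add: h_def P_def piece_rescale Let_def)
    have g_off: "g z = z" if "\<And>k i. z \<notin> P k i" for z
      using bilip_onD(3)[OF g(1)] that by blast
    have c_off: "c z = z" if "\<And>k. z \<notin> P k 0" for z
      using bilip_onD(3)[OF c] that by (auto simp: Z'_def)
    have cP: "c z \<in> P k 0" if "z \<in> P k 0" for z k
    proof -
      have "k \<noteq> 0" using that by (auto simp: P0)
      then have "frontier (P k 0) = {a k + real k / 4, a k + real k / 2}" by (rule frontier_P0)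
      then show ?thesis
        using bilip_on_fixes_interval[OF c ends[of "a k + real k / 4" k] ends[of "a k + real k / 2" k]] that
        by (simp add: P_def piece_def)
    qed
    have "g (s z) = c (s (g z))" for z
    proof (cases "\<exists>k i. z \<in> P k i")
      case True
      then obtain k i where z: "z \<in> P k i" by blast
      have half: "s w = a k + (w - a k) / 2 \<and> s w \<in> P k (Suc i)" if "w \<in> P k i" for w
        using s_half[of w k] that PU[of k i] piece_subset(2)[of "real k" "a k" i]
          piece_half[of "a k" w "real k" i]
        by (force simp: P_def)
      define w where "w = c (a k + 2 ^ i * (z - a k))"
      have gz: "g z = a k + (w - a k) / 2 ^ i" using gP[OF z] by (simp add: w_def)
      have "w \<in> P k 0" unfolding w_def using cP z by (simp add: P_def piece_rescale)
      moreover have "a k + 2 ^ i * (g z - a k) = w" by (simp add: gz)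
      ultimately have "g z \<in> P k i"
        using piece_rescale[of "a k" i "g z" "real k"] by (simp add: P_def)
      then have sgz: "s (g z) = a k + (w - a k) / 2 ^ Suc i" "s (g z) \<in> P k (Suc i)"
        using half[of "g z"] gz by auto
      then have "c (s (g z)) = s (g z)"
        using P_eq[of "s (g z)" k "Suc i" _ 0] by (intro c_off) blast
      moreover have "g (s z) = a k + (w - a k) / 2 ^ Suc i"
        using gP[OF conjunct2[OF half[OF z]]] half[OF z] by (simp add: w_def)
      ultimately show ?thesis using sgz by simp
    next
      case False
      then have gz: "g z = z" using g_off by blast
      have "g (s z) = c (s z)"
      proof (cases "\<exists>k i. s z \<in> P k i")
        case True
        then obtain k i where sz: "s z \<in> P k i" by blast
        have zU: "z \<in> U k"
        proof (rule ccontr)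
          assume "z \<notin> U k"
          moreover have szU: "s z \<in> U k" using sz PU by blast
          ultimately have "s z \<noteq> z" by metis
          then obtain l where "z \<in> U l" using bilip_onD(3)[OF s(1), of z] by blast
          then have "s z \<in> U l" "l \<noteq> k" using sU \<open>z \<notin> U k\<close> by auto
          then show False using U_disj[of l k] szU by blast
        qed
        show ?thesis
        proof (cases i)
          case 0
          then show ?thesis using gP[OF sz] by simp
        next
          case (Suc j)
          \<comment> \<open>Then \<open>s z\<close> lies in the first quarter, so \<open>z\<close> would lie in the preceding piece.\<close>
          have "s z < a k + real k / 4"
          proof -
            have "real k / 2 ^ (Suc j + 1) \<le> real k / 4"
              by (rule divide_left_mono) (auto simp: power_add)
            then show ?thesis using sz Suc by (auto simp: P_def piece_def)
          qed
          then have "z \<le> a k + real k / 2"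
            using s(2)[OF zU] zU by (auto simp: contract_def U_def max_def split: if_splits)
          then have "z \<in> P k j"
            using s_half[OF zU] sz Suc piece_half[of "a k" z "real k" j] by (simp add: P_def)
          with False show ?thesis by blast
        qed
      qed (use g_off c_off in metis)
      with gz show ?thesis by simp
    qed
    moreover have "g \<in> bilip_on Z"
      by (rule bilip_on_mono[OF g(1)]) (use PU a(1) in \<open>unfold U_def, blast\<close>)
    ultimately show "\<exists>g\<in>bilip_on Z. g \<circ> s = c \<circ> s \<circ> g" by (auto simp: fun_eq_iff)
  qed
qed


section \<open>Actions on the line\<close>

definition coarse_maps :: "(real \<Rightarrow> real) set" where
  "coarse_maps = {f. quasi_isometry f \<and> filterlim f at_top at_top \<and> filterlim f at_bot at_bot}"

lemma coarse_maps_comp: "f \<in> coarse_maps \<Longrightarrow> g \<in> coarse_maps \<Longrightarrow> f \<circ> g \<in> coarse_maps"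
  unfolding coarse_maps_def comp_def
  by (auto intro: filterlim_compose quasi_isometry_comp[unfolded comp_def])

lemma bilip_on_coarse:
  assumes "f \<in> bilip_on Y"
  shows "f \<in> coarse_maps"
proof -
  have "quasi_isometry f"
  proof (rule quasi_isometryI[of 2 0 0 0])
    show "\<exists>x. dist (f x) y \<le> 0" for y
      using bilip_on_surj[OF assms] by (metis dist_self order_refl surjD)
  qed (use bilip_on_dist[OF assms] in \<open>auto simp: field_simps\<close>)
  moreover have "filterlim f at_top at_top"
    unfolding filterlim_at_top eventually_at_top_linorder
  proof (intro allI exI impI)
    fix M x assume "max 0 (2 * (M - f 0)) \<le> x"
    then show "M \<le> f x" using bilip_onD(1)[OF assms, of 0 x] by simp
  qed
  moreover have "filterlim f at_bot at_bot"
    unfolding filterlim_at_bot eventually_at_bot_linorder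
  proof (intro allI exI impI)
    fix M x assume "x \<le> min 0 (2 * (M - f 0))"
    then show "f x \<le> M" using bilip_onD(1)[OF assms, of x 0] by simp
  qed
  ultimately show ?thesis by (simp add: coarse_maps_def)
qed

text \<open>The locale collects the consequences of the existence of a faithful action; it turns out to be
inconsistent.\<close>

locale line_action =
  fixes \<phi> :: "(real \<Rightarrow> real) set \<Rightarrow> real \<Rightarrow> real"
  assumes hom: "\<phi> \<in> hom QI_plus Homeo" and inj: "inj_on \<phi> (carrier QI_plus)"
begin

definition act :: "(real \<Rightarrow> real) \<Rightarrow> real \<Rightarrow> real" where
  "act f = \<phi> (qi_rel `` {f})"

lemma class_carrier: "f \<in> coarse_maps \<Longrightarrow> qi_rel `` {f} \<in> carrier QI_plus"
  by (auto simp: QI_plus_def coarse_maps_def)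

lemma act_comp:
  assumes "f \<in> coarse_maps" "g \<in> coarse_maps"
  shows "act (f \<circ> g) = act f \<circ> act g"
proof -
  have "qi_rel `` {f} \<otimes>\<^bsub>QI_plus\<^esub> qi_rel `` {g} = qi_rel `` {f \<circ> g}"
    using qi_mult_class[of f g] assms by (simp add: QI_plus_def coarse_maps_def)
  then show ?thesis
    using hom_mult[OF hom class_carrier[OF assms(1)] class_carrier[OF assms(2)]]
    by (simp add: act_def Homeo_def)
qed

lemma act_cont_inj:
  assumes "f \<in> coarse_maps"
  shows "continuous_on UNIV (act f)" "inj (act f)"
proof -
  have "act f \<in> carrier Homeo"
    using hom class_carrier[OF assms] by (auto simp: act_def hom_def)
  then obtain k where k: "homeomorphism UNIV UNIV (act f) k" by (auto simp: Homeo_def)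
  then show "continuous_on UNIV (act f)" by (simp add: homeomorphism_def)
  show "inj (act f)" using k by (metis homeomorphism_apply1 injI UNIV_I)
qed

lemma act_id: "act id = id"
proof -
  have id: "id \<in> coarse_maps" by (rule bilip_on_coarse[OF id_in_bilip_on])
  have "act id (act id x) = act id x" for x
    using act_comp[OF id id] by (simp add: fun_eq_iff)
  then show ?thesis using act_cont_inj(2)[OF id] by (auto simp: fun_eq_iff inj_eq)
qed

lemma act_eq_iff:
  assumes "f \<in> coarse_maps" "g \<in> coarse_maps"
  shows "act f = act g \<longleftrightarrow> (\<exists>B. \<forall>x. dist (f x) (g x) \<le> B)"
proof -
  have q: "quasi_isometry f" "quasi_isometry g" using assms by (auto simp: coarse_maps_def)
  have "act f = act g \<longleftrightarrow> qi_rel `` {f} = qi_rel `` {g}"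
    unfolding act_def using inj_on_eq_iff[OF inj class_carrier class_carrier] assms by blast
  also have "\<dots> \<longleftrightarrow> (f, g) \<in> qi_rel"
    using eq_equiv_class_iff[OF equiv_qi_rel] q by blast
  finally show ?thesis using q by (simp add: qi_rel_iff)
qed

lemma act_bilip_comp:
  "f \<in> bilip_on Y \<Longrightarrow> g \<in> bilip_on Z \<Longrightarrow> act (f \<circ> g) = act f \<circ> act g"
  by (simp add: act_comp bilip_on_coarse)

lemma act_inverse:
  assumes "f \<in> bilip_on Y"
  obtains g where "g \<in> bilip_on Y" "\<And>x. act g (act f x) = x"
proof -
  obtain g where g: "g \<in> bilip_on Y" "f \<circ> g = id" "g \<circ> f = id"
    by (rule bilip_on_inverse[OF assms])
  then show ?thesis
    using that act_bilip_comp[OF assms g(1)] act_bilip_comp[OF g(1) assms] act_id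
    by (metis comp_apply id_apply)
qed

text \<open>Cutting a map off at \<open>R\<close> changes it only on a bounded interval, since it fixes 0 and \<open>R\<close>; the class
is unchanged.\<close>

lemma act_tail:
  assumes f: "f \<in> bilip_on Y" and Y: "Y \<subseteq> {0<..}" "R \<notin> Y"
  obtains f' where "f' \<in> bilip_on (Y \<inter> {R<..})" "act f' = act f"
proof
  define f' where "f' z = (if z \<in> {R<..} then f z else z)" for z
  show f': "f' \<in> bilip_on (Y \<inter> {R<..})"
    unfolding f'_def by (rule bilip_on_restrict[OF f]) (use bilip_onD(3)[OF f Y(2)] in auto)
  have "dist (f' z) (f z) \<le> \<bar>R\<bar>" for z
  proof (cases "z \<in> {0<..R}")
    case True
    have "f 0 = 0" "f R = R" using Y by (auto intro: bilip_onD(3)[OF f])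
    then show ?thesis
      using True bilip_onD(1)[OF f, of 0 z] bilip_onD(1)[OF f, of z R]
      by (simp add: f'_def dist_real_def abs_le_iff)
  next
    case False
    then have "z \<notin> Y \<or> R < z" using Y(1) by auto
    then have "f' z = f z" using bilip_onD(3)[OF f, of z] by (auto simp: f'_def)
    then show ?thesis by simp
  qed
  then show "act f' = act f"
    using act_eq_iff[OF bilip_on_coarse[OF f'] bilip_on_coarse[OF f]] by blast
qed

text \<open>The orientation character of the action takes values in a commutative group.\<close>

lemma act_commutator_strict_mono:
  assumes "c \<in> bilip_on X" "s \<in> bilip_on Y" "g \<in> bilip_on Z" "g \<circ> s = c \<circ> s \<circ> g"
  shows "strict_mono (act c)"
proof -
  have mono_or_anti: "(\<forall>x y. x < y \<longrightarrow> act f x < act f y) \<or> (\<forall>x y. x < y \<longrightarrow> act f y < act f x)"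
    if "f \<in> bilip_on W" for f W
    using injective_eq_monotone_map[of UNIV "act f"] act_cont_inj[OF bilip_on_coarse[OF that]]
    by (auto simp: monotone_on_def)
  have "act g \<circ> act s = act c \<circ> act s \<circ> act g"
    using assms by (metis act_comp bilip_on_coarse coarse_maps_comp)
  then have eq: "act g (act s x) = act c (act s (act g x))" for x by (simp add: fun_eq_iff)
  have "\<not> (\<forall>x y. x < y \<longrightarrow> act c y < act c x)"
    using mono_or_anti[OF assms(2)] mono_or_anti[OF assms(3)] eq[of 0] eq[of 1]
    by (metis less_asym zero_less_one)
  then show ?thesis using mono_or_anti[OF assms(1)] by (auto intro: strict_monoI)
qed

text \<open>Consider the supremum of \<open>h\<close> over the maps supported in a set. It decreases with the set, and it is
insensitive to cutting off a bounded part. Choose a decreasing sequence of thick sets, each of which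
nearly attains the infimum of the suprema over all thick subsets of its predecessor. On a
pseudo-intersection the supremum cannot drop any more.\<close>

lemma stabilise:
  fixes h :: "(real \<Rightarrow> real) \<Rightarrow> real"
  assumes "thick Y" and bounded: "\<And>f. \<bar>h f\<bar> \<le> B"
  obtains Y0 where "thick Y0" "Y0 \<subseteq> Y"
    "\<And>Y' f e. thick Y' \<Longrightarrow> Y' \<subseteq> Y0 \<Longrightarrow> f \<in> bilip_on Y0 \<Longrightarrow> e < h (act f) \<Longrightarrow>
       \<exists>f'\<in>bilip_on Y'. e < h (act f')"
proof -
  define v where "v Y = (SUP f\<in>bilip_on Y. h (act f))" for Y
  have bdd: "bdd_above ((\<lambda>f. h (act f)) ` bilip_on Y)" for Y
    using bounded by (intro bdd_aboveI[of _ B]) (auto simp: abs_le_iff)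
  have ne: "bilip_on Y \<noteq> {}" for Y using id_in_bilip_on by blast
  have v_mono: "v Y \<le> v Z" if "Y \<subseteq> Z" for Y Z
    unfolding v_def by (rule cSUP_mono[OF ne bdd]) (use that in \<open>auto intro: bilip_on_mono\<close>)
  have v_lower: "- B \<le> v Y" for Y
    using cSUP_upper[OF id_in_bilip_on bdd, of Y] bounded[of "act id"]
    unfolding v_def by (simp add: abs_le_iff)
  have v_tail: "v Z = v (Z \<inter> {R<..})" if "Z \<subseteq> {0<..}" "R \<notin> Z" for Z R
  proof (rule antisym)
    show "v Z \<le> v (Z \<inter> {R<..})"
      unfolding v_def
    proof (rule cSUP_mono[OF ne bdd])
      fix f assume "f \<in> bilip_on Z"
      then show "\<exists>f'\<in>bilip_on (Z \<inter> {R<..}). h (act f) \<le> h (act f')"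
        using act_tail[OF _ that] by (metis order_refl)
    qed
  qed (rule v_mono, blast)
  have v_bdd: "bdd_below (v ` A)" for A using v_lower by (rule bdd_belowI2)
  define m where "m Y = (INF Z\<in>{Z. thick Z \<and> Z \<subseteq> Y}. v Z)" for Y
  have m_lower: "m Y \<le> v Z" if "thick Z" "Z \<subseteq> Y" for Y Z
    unfolding m_def by (rule cINF_lower[OF v_bdd]) (use that in auto)
  have "\<exists>Ys. \<forall>n. (thick (Ys n) \<and> Ys n \<subseteq> Y) \<and>
      (Ys (Suc n) \<subseteq> Ys n \<and> v (Ys (Suc n)) < m (Ys n) + 1 / real (Suc n))"
  proof (rule dependent_nat_choice)
    fix X n assume X: "thick X \<and> X \<subseteq> Y"
    have "\<exists>Z\<in>{Z. thick Z \<and> Z \<subseteq> X}. v Z < m X + 1 / real (Suc n)"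
      unfolding m_def
      by (subst cINF_less_iff[OF _ v_bdd, symmetric]) (use X in auto)
    then show "\<exists>Z. (thick Z \<and> Z \<subseteq> Y) \<and> (Z \<subseteq> X \<and> v Z < m X + 1 / real (Suc n))"
      using X by auto
  qed (use assms(1) in blast)
  then obtain Ys where Ys: "\<And>n. thick (Ys n)" "\<And>n. Ys n \<subseteq> Y" "\<And>n. Ys (Suc n) \<subseteq> Ys n"
    "\<And>n. v (Ys (Suc n)) < m (Ys n) + 1 / real (Suc n)" by blast
  obtain Z where Z: "thick Z" "Z \<subseteq> Ys 0" "Z \<subseteq> {0<..}"
      "\<And>n. \<exists>R. R \<notin> Z \<and> Z \<inter> {R<..} \<subseteq> Ys n"
    using thick_pseudo_intersection[of Ys] Ys by blast
  show ?thesis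
  proof (rule that[OF Z(1)])
    show "Z \<subseteq> Y" using Z(2) Ys(2) by blast
    fix Y' f e assume Y': "thick Y'" "Y' \<subseteq> Z" and f: "f \<in> bilip_on Z" "e < h (act f)"
    have "v Z < v Y' + 1 / real (Suc n)" for n
    proof -
      obtain R where R: "R \<notin> Z" "Z \<inter> {R<..} \<subseteq> Ys (Suc n)" using Z(4) by blast
      have "v Z = v (Z \<inter> {R<..})" by (rule v_tail[OF Z(3) R(1)])
      also have "\<dots> \<le> v (Ys (Suc n))" by (rule v_mono[OF R(2)])
      also have "\<dots> < m (Ys n) + 1 / real (Suc n)" by (rule Ys(4))
      also have "m (Ys n) \<le> v (Y' \<inter> {R<..})"
        using Y' R(2) Ys(3)[of n] thick_tail[OF Y'(1)] by (intro m_lower) blast+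
      also have "v (Y' \<inter> {R<..}) = v Y'"
        by (rule v_tail[symmetric]) (use Y' Z(3) R(1) in auto)
      finally show ?thesis by simp
    qed
    then have "v Z \<le> v Y'"
      by (metis add_diff_cancel_left' diff_gt_0_iff_gt inverse_eq_divide linorder_not_le
          not_less_iff_gr_or_eq reals_Archimedean add.commute less_diff_eq less_trans)
    moreover have "h (act f) \<le> v Z" unfolding v_def by (rule cSUP_upper[OF f(1) bdd])
    ultimately have "e < v Y'" using f(2) by linarith
    then show "\<exists>f'\<in>bilip_on Y'. e < h (act f')"
      unfolding v_def by (subst (asm) less_cSUP_iff[OF ne bdd])
  qed
qed

text \<open>If \<open>x\<close> were moved, an infinite product \<open>F\<close> of swindle maps would send it into an open interval \<open>I\<close>
while avoiding each of countably many intervals that cover \<open>I\<close>.\<close>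

lemma stable_point_fixed:
  assumes Y: "thick Y" and mono: "\<And>f. f \<in> bilip_on Y \<Longrightarrow> strict_mono (act f)"
    and up: "\<And>Y' f y. thick Y' \<Longrightarrow> Y' \<subseteq> Y \<Longrightarrow> f \<in> bilip_on Y \<Longrightarrow> y < act f x \<Longrightarrow>
       \<exists>f'\<in>bilip_on Y'. y < act f' x"
    and down: "\<And>Y' f y. thick Y' \<Longrightarrow> Y' \<subseteq> Y \<Longrightarrow> f \<in> bilip_on Y \<Longrightarrow> act f x < y \<Longrightarrow>
       \<exists>f'\<in>bilip_on Y'. act f' x < y"
    and f0: "f0 \<in> bilip_on Y"
  shows "act f0 x = x"
proof (rule ccontr)
  assume moved: "act f0 x \<noteq> x"
  define I where
    "I = {y. (\<exists>f\<in>bilip_on Y. y < act f x) \<and> (\<exists>f\<in>bilip_on Y. act f x < y)}"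
  have less: "act f y < act f z \<longleftrightarrow> y < z" if "f \<in> bilip_on Y" for f y z
    using mono[OF that] by (simp add: strict_mono_less)
  have xI: "x \<in> I"
  proof -
    obtain g0 where g0: "g0 \<in> bilip_on Y" "act g0 (act f0 x) = x" by (metis act_inverse f0)
    consider "x < act f0 x" "act g0 x < x" | "act f0 x < x" "x < act g0 x"
      using moved g0(2) less[OF g0(1), of x "act f0 x"] less[OF g0(1), of "act f0 x" x]
      by fastforce
    then show ?thesis using f0 g0(1) unfolding I_def by cases blast+
  qed
  have I_inv: "act g y \<in> I"
    if g: "g \<in> bilip_on X" "X \<subseteq> Y" and X': "thick X'" "X' \<subseteq> Y" "X \<inter> X' = {}" and y: "y \<in> I"
    for g X X' y
  proof -
    obtain f1 f2 where f: "f1 \<in> bilip_on X'" "y < act f1 x" "f2 \<in> bilip_on X'" "act f2 x < y"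
      using y up[OF X'(1,2)] down[OF X'(1,2)] unfolding I_def by blast
    have gY: "g \<in> bilip_on Y" using g by (rule bilip_on_mono)
    have "g \<circ> f1 \<in> bilip_on Y" "g \<circ> f2 \<in> bilip_on Y"
      using bilip_on_comp_disjoint[OF g(1) _ X'(3)] f g(2) X'(2) by (metis Un_least bilip_on_mono)+
    moreover have "act g y < act (g \<circ> f1) x" "act (g \<circ> f2) x < act g y"
      using f less[OF gY] act_bilip_comp[OF gY f(1)] act_bilip_comp[OF gY f(3)] by auto
    ultimately show ?thesis unfolding I_def by blast
  qed
  \<comment> \<open>On disjoint thick parts of \<open>W\<close> take \<open>a\<close> sending \<open>x\<close> beyond \<open>u\<close> and \<open>b\<close> sending \<open>x\<close> beyond \<open>w\<close> on
    the other side; the composite of \<open>a\<close> with the inverse of \<open>b\<close> pushes \<open>w\<close> beyond \<open>u\<close>.\<close>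
  have push: "\<exists>c\<in>bilip_on W. u < act c w" "\<exists>c\<in>bilip_on W. act c w < u"
    if W: "thick W" "W \<subseteq> Y" and I: "u \<in> I" "w \<in> I" for W u w
  proof -
    obtain V :: "nat \<Rightarrow> real set" where V: "\<And>n. thick (V n)" "\<And>n. V n \<subseteq> W"
      "\<And>m n. m \<noteq> n \<Longrightarrow> V m \<inter> V n = {}" using thick_split[OF W(1)] by blast
    have VY: "V n \<subseteq> Y" for n using V(2) W(2) by blast
    have *: "\<exists>c\<in>bilip_on W. act c (act b x) = act a x"
      if a: "a \<in> bilip_on (V 0)" and b: "b \<in> bilip_on (V 1)" for a b
    proof -
      obtain b' where b': "b' \<in> bilip_on (V 1)" "act b' (act b x) = x"
        by (metis act_inverse[OF b])
      have "a \<circ> b' \<in> bilip_on W"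
        using bilip_on_comp_disjoint[OF a b'(1)] V(2,3)[of 0] V(2)[of 1]
        by (metis Un_least V(3) bilip_on_mono zero_neq_one)
      then show ?thesis using act_bilip_comp[OF a b'(1)] b'(2) by (metis comp_apply)
    qed
    obtain a b where a: "a \<in> bilip_on (V 0)" "u < act a x" and b: "b \<in> bilip_on (V 1)" "act b x < w"
      using I up[OF V(1) VY] down[OF V(1) VY] unfolding I_def by blast
    obtain c where c: "c \<in> bilip_on W" "act c (act b x) = act a x" using *[OF a(1) b(1)] by blast
    have "act a x < act c w" using less[OF bilip_on_mono[OF c(1) W(2)]] b(2) c(2) by metis
    with a(2) c(1) show "\<exists>c\<in>bilip_on W. u < act c w" by (meson less_trans)
    obtain a b where a: "a \<in> bilip_on (V 0)" "act a x < u" and b: "b \<in> bilip_on (V 1)" "w < act b x"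
      using I up[OF V(1) VY] down[OF V(1) VY] unfolding I_def by blast
    obtain c where c: "c \<in> bilip_on W" "act c (act b x) = act a x" using *[OF a(1) b(1)] by blast
    have "act c w < act a x" using less[OF bilip_on_mono[OF c(1) W(2)]] b(2) c(2) by metis
    with a(2) c(1) show "\<exists>c\<in>bilip_on W. act c w < u" by (meson less_trans)
  qed
  obtain Z :: "nat \<Rightarrow> real set" where Z: "\<And>n. thick (Z n)" "\<And>n. Z n \<subseteq> Y"
    "\<And>m n. m \<noteq> n \<Longrightarrow> Z m \<inter> Z n = {}" using thick_split[OF Y] by blast
  define p where "p n = real_of_rat (fst (from_nat n :: rat \<times> rat))" for n
  define q where "q n = real_of_rat (snd (from_nat n :: rat \<times> rat))" for n
  \<comment> \<open>The set \<open>Z 0\<close> stays free, so that all these maps preserve \<open>I\<close>. The identity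
    \<open>g \<circ> s = c \<circ> s \<circ> g\<close> at \<open>x\<close> compares \<open>c\<close> at \<open>s (g x)\<close> with \<open>g\<close> at \<open>s x\<close>. Only the side of \<open>x\<close> to
    which \<open>s\<close> moves it decides in which direction \<open>c\<close> has to push, and it is known before \<open>c\<close> is
    chosen.\<close>
  have "\<exists>s c g. s \<in> bilip_on (Z (Suc n)) \<and> c \<in> bilip_on (Z (Suc n)) \<and> g \<in> bilip_on (Z (Suc n)) \<and>
      g \<circ> s = c \<circ> s \<circ> g \<and>
      (p n \<in> I \<longrightarrow> q n \<in> I \<longrightarrow>
        (if x \<le> act s x then act c (act s (q n)) < p n else q n < act c (act s (p n))))" for n
  proof -
    obtain s W where s: "s \<in> bilip_on (Z (Suc n))" "thick W" "W \<subseteq> Z (Suc n)"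
      "\<And>c. c \<in> bilip_on W \<Longrightarrow> \<exists>g\<in>bilip_on (Z (Suc n)). g \<circ> s = c \<circ> s \<circ> g"
      by (rule swindle[OF Z(1)[of "Suc n"]]) blast
    have sI: "act s y \<in> I" if "y \<in> I" for y
      by (rule I_inv[OF s(1) Z(2) Z(1)[of 0] Z(2) Z(3) that]) simp
    have WY: "W \<subseteq> Y" using s(3) Z(2) by blast
    have "\<exists>c\<in>bilip_on W. p n \<in> I \<longrightarrow> q n \<in> I \<longrightarrow>
        (if x \<le> act s x then act c (act s (q n)) < p n else q n < act c (act s (p n)))"
      using push[OF s(2) WY] sI id_in_bilip_on[of W] by (smt (verit))
    then show ?thesis using s(1,4) bilip_on_mono[OF _ s(3)] by meson
  qed
  then obtain s c g where s: "\<And>n. s n \<in> bilip_on (Z (Suc n))"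
    and c: "\<And>n. c n \<in> bilip_on (Z (Suc n))" and g: "\<And>n. g n \<in> bilip_on (Z (Suc n))"
    and gs: "\<And>n. g n \<circ> s n = c n \<circ> s n \<circ> g n"
    and far: "\<And>n. p n \<in> I \<Longrightarrow> q n \<in> I \<Longrightarrow>
        (if x \<le> act (s n) x then act (c n) (act (s n) (q n)) < p n
         else q n < act (c n) (act (s n) (p n)))"
    by metis
  have disj: "Z (Suc m) \<inter> Z (Suc n) = {}" if "m \<noteq> n" for m n using Z(3) that by simp
  obtain F where F: "F \<in> bilip_on (\<Union>n. Z (Suc n))" "\<And>n z. z \<in> Z (Suc n) \<Longrightarrow> F z = g n z"
    using bilip_on_glue[of g "\<lambda>n. Z (Suc n)"] g disj by blast
  have FY: "F \<in> bilip_on Y" by (rule bilip_on_mono[OF F(1)]) (use Z(2) in blast)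
  have "act F x \<in> I"
    by (rule I_inv[OF F(1) _ Z(1)[of 0] Z(2) _ xI]) (use Z(2,3) in blast)+
  then obtain f1 f2 where f: "f1 \<in> bilip_on Y" "act F x < act f1 x"
    "f2 \<in> bilip_on Y" "act f2 x < act F x"
    unfolding I_def by blast
  obtain a b where ab: "act f2 x < of_rat a" "of_rat a < act F x" "act F x < of_rat b"
      "of_rat b < act f1 x"
    using of_rat_dense[OF f(2)] of_rat_dense[OF f(4)] by blast
  obtain n where n: "from_nat n = (a, b)" by (metis surj_from_nat surjD)
  have pq: "p n < act F x" "act F x < q n" using ab by (simp_all add: p_def q_def n)
  have "act f2 x < p n" "p n < act f1 x" "act f2 x < q n" "q n < act f1 x"
    using ab by (simp_all add: p_def q_def n)
  then have pqI: "p n \<in> I" "q n \<in> I" using f(1,3) unfolding I_def by blast+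
  \<comment> \<open>\<open>F\<close> agrees with \<open>g n\<close> on \<open>Z (Suc n)\<close>; its other factors commute with \<open>s n\<close> and \<open>c n\<close>.\<close>
  have "F \<circ> s n = c n \<circ> s n \<circ> F"
  proof
    fix z
    show "(F \<circ> s n) z = (c n \<circ> s n \<circ> F) z"
    proof (cases "z \<in> Z (Suc n)")
      case True
      then have "s n z \<in> Z (Suc n)" using bilip_on_image_iff[OF s] by blast
      then show ?thesis using True F(2) fun_cong[OF gs, of n z] by simp
    next
      case False
      have "F z \<notin> Z (Suc n)"
      proof (cases "z \<in> (\<Union>n. Z (Suc n))")
        case True
        then obtain m where m: "z \<in> Z (Suc m)" by blast
        then have "F z \<in> Z (Suc m)" using F(2) bilip_on_image_iff[OF g] by metis
        then show ?thesis using m False disj[of m n] by blast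
      qed (use False bilip_onD(3)[OF F(1)] in metis)
      then show ?thesis
        using False bilip_onD(3)[OF s[of n]] bilip_onD(3)[OF c[of n]] by simp
    qed
  qed
  then have "act F \<circ> act (s n) = act (c n) \<circ> act (s n) \<circ> act F"
    using FY s[of n] c[of n] by (metis act_comp bilip_on_coarse coarse_maps_comp)
  then have key: "act F (act (s n) x) = act (c n) (act (s n) (act F x))"
    by (simp add: fun_eq_iff)
  have sY: "s n \<in> bilip_on Y" and cY: "c n \<in> bilip_on Y"
    using bilip_on_mono[OF s Z(2)] bilip_on_mono[OF c Z(2)] by auto
  show False
  proof (cases "x \<le> act (s n) x")
    case True
    have "act F x \<le> act F (act (s n) x)" using less[OF FY] True by (simp add: linorder_not_less[symmetric])
    also have "\<dots> < act (c n) (act (s n) (q n))" unfolding key using less[OF sY] less[OF cY] pq by simp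
    also have "\<dots> < p n" using far[OF pqI] True by simp
    finally show False using pq by simp
  next
    case False
    have "q n < act (c n) (act (s n) (p n))" using far[OF pqI] False by simp
    also have "\<dots> < act F (act (s n) x)" unfolding key using less[OF sY] less[OF cY] pq by simp
    also have "\<dots> < act F x" using less[OF FY] False by simp
    finally show False using pq by simp
  qed
qed

text \<open>Stabilise the supremum of the images of \<open>x\<close>, then their infimum; the arctangent makes both finite.\<close>

lemma thick_fixing_point:
  assumes Y: "thick Y" and mono: "\<And>f. f \<in> bilip_on Y \<Longrightarrow> strict_mono (act f)"
  obtains Y' where "thick Y'" "Y' \<subseteq> Y" "\<And>f. f \<in> bilip_on Y' \<Longrightarrow> act f x = x"
proof -
  have bound: "\<bar>arctan y\<bar> \<le> pi" "\<bar>- arctan y\<bar> \<le> pi" for y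
    using arctan_bounded[of y] pi_gt_zero by (simp_all add: abs_le_iff)
  obtain Y1 where Y1: "thick Y1" "Y1 \<subseteq> Y"
    "\<And>Y' f e. thick Y' \<Longrightarrow> Y' \<subseteq> Y1 \<Longrightarrow> f \<in> bilip_on Y1 \<Longrightarrow> e < arctan (act f x) \<Longrightarrow>
       \<exists>f'\<in>bilip_on Y'. e < arctan (act f' x)"
    by (rule stabilise[OF Y, of "\<lambda>f. arctan (f x)" pi, OF bound(1)]) blast
  obtain Y2 where Y2: "thick Y2" "Y2 \<subseteq> Y1"
    "\<And>Y' f e. thick Y' \<Longrightarrow> Y' \<subseteq> Y2 \<Longrightarrow> f \<in> bilip_on Y2 \<Longrightarrow> e < - arctan (act f x) \<Longrightarrow>
       \<exists>f'\<in>bilip_on Y'. e < - arctan (act f' x)"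
    by (rule stabilise[OF Y1(1), of "\<lambda>f. - arctan (f x)" pi, OF bound(2)]) blast
  show ?thesis
  proof (rule that[OF Y2(1)])
    show "Y2 \<subseteq> Y" using Y1(2) Y2(2) by blast
    fix f assume f: "f \<in> bilip_on Y2"
    show "act f x = x"
    proof (rule stable_point_fixed[OF Y2(1) _ _ _ f])
      show "strict_mono (act f)" if "f \<in> bilip_on Y2" for f
        using mono that Y1(2) Y2(2) bilip_on_mono by blast
      fix Y' f y assume Y': "thick Y'" "Y' \<subseteq> Y2" and f: "f \<in> bilip_on Y2"
      show "\<exists>f'\<in>bilip_on Y'. y < act f' x" if "y < act f x"
        using Y1(3)[of Y' f "arctan y"] Y' Y2(2) bilip_on_mono[OF f Y2(2)] that
        by (auto simp: arctan_less_iff)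
      show "\<exists>f'\<in>bilip_on Y'. act f' x < y" if "act f x < y"
        using Y2(3)[of Y' f "- arctan y"] Y' f that by (auto simp: arctan_less_iff)
    qed
  qed
qed

text \<open>The maps supported in a thick set \<open>X\<close> given by the swindle are commutators, hence act by increasing
homeomorphisms. Below \<open>X\<close>, shrink successively to thick sets fixing each rational. A
pseudo-intersection \<open>Z\<close> fixes them all, so by monotonicity its maps act trivially; but some map
supported in \<open>Z\<close> has unbounded displacement.\<close>

lemma inconsistent: False
proof -
  obtain s X where X: "thick X"
    "\<And>c. c \<in> bilip_on X \<Longrightarrow> \<exists>g\<in>bilip_on UNIV. g \<circ> s = c \<circ> s \<circ> g"
    and s: "s \<in> bilip_on UNIV"
    by (rule swindle[OF thick_UNIV]) blast
  have mono: "strict_mono (act c)" if "c \<in> bilip_on X" for c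
    using X(2)[OF that] act_commutator_strict_mono[OF that s] by blast
  define r where "r n = real_of_rat (from_nat n)" for n
  have step: "\<exists>Z. (thick Z \<and> Z \<subseteq> X) \<and> Z \<subseteq> Y \<and> (\<forall>f\<in>bilip_on Z. act f (r n) = r n)"
    if Y: "thick Y \<and> Y \<subseteq> X" for Y n
  proof -
    have "strict_mono (act f)" if "f \<in> bilip_on Y" for f
      using mono bilip_on_mono[OF that] Y by blast
    then obtain Z where "thick Z" "Z \<subseteq> Y" "\<And>f. f \<in> bilip_on Z \<Longrightarrow> act f (r n) = r n"
      using thick_fixing_point[of Y "r n"] Y by metis
    then show ?thesis using Y by blast
  qed
  have "\<exists>Y. \<forall>n. (thick (Y n) \<and> Y n \<subseteq> X) \<and>
      (Y (Suc n) \<subseteq> Y n \<and> (\<forall>f\<in>bilip_on (Y (Suc n)). act f (r n) = r n))"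
    by (rule dependent_nat_choice) (use X(1) step in blast)+
  then obtain Y where Y: "\<And>n. thick (Y n)" "\<And>n. Y n \<subseteq> X" "\<And>n. Y (Suc n) \<subseteq> Y n"
    "\<And>n f. f \<in> bilip_on (Y (Suc n)) \<Longrightarrow> act f (r n) = r n" by blast
  obtain Z where Z: "thick Z" "Z \<subseteq> Y 0" "Z \<subseteq> {0<..}"
      "\<And>n. \<exists>R. R \<notin> Z \<and> Z \<inter> {R<..} \<subseteq> Y n"
    using thick_pseudo_intersection[of Y] Y by blast
  obtain t where t: "t \<in> bilip_on Z" "\<And>B. \<exists>z. B < dist (t z) z"
    by (rule swindle[OF Z(1)]) blast
  have fixed: "act t (r n) = r n" for n
  proof -
    obtain R where R: "R \<notin> Z" "Z \<inter> {R<..} \<subseteq> Y (Suc n)" using Z(4) by blast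
    obtain f' where "f' \<in> bilip_on (Z \<inter> {R<..})" "act f' = act t"
      by (rule act_tail[OF t(1) Z(3) R(1)])
    then show ?thesis using Y(4)[of f' n] bilip_on_mono[OF _ R(2)] by metis
  qed
  have t_mono: "strict_mono (act t)"
    using mono bilip_on_mono[OF t(1)] Z(2) Y(2) by blast
  have fixed_rat: "act t (of_rat a) = of_rat a" for a
    using fixed[of "to_nat a"] by (simp add: r_def)
  have "act t y = y" for y
  proof (rule ccontr)
    assume "act t y \<noteq> y"
    then consider "act t y < y" | "y < act t y" by linarith
    then show False
    proof cases
      case 1
      then obtain a where "act t y < of_rat a" "of_rat a < y" using of_rat_dense by blast
      then show False using strict_monoD[OF t_mono, of "of_rat a" y] fixed_rat[of a] by simp
    next
      case 2
      then obtain a where "y < of_rat a" "of_rat a < act t y" using of_rat_dense by blast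
      then show False using strict_monoD[OF t_mono, of y "of_rat a"] fixed_rat[of a] by simp
    qed
  qed
  then have "act t = act id" by (simp add: act_id fun_eq_iff)
  then obtain B where "\<And>z. dist (t z) z \<le> B"
    using act_eq_iff[OF bilip_on_coarse[OF t(1)] bilip_on_coarse[OF id_in_bilip_on]] by auto
  then show False using t(2)[of B] by (meson linorder_not_less)
qed

end

theorem theorem1p3:
  "\<not> (\<exists>\<phi>. \<phi> \<in> hom QI_plus (Homeo :: (real \<Rightarrow> real) monoid) \<and> inj_on \<phi> (carrier QI_plus))"
  using line_action.inconsistent line_action.intro by blast

end
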